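(* Let $p$ be a prime, let $G$ be a finite $p$-group and write $d=\log_p|G':(G')^p|$. If $d\le p-1$ and the action of $G$ on $G'$ is uniserial modulo $(G')^p$, then there exists $x\in G$ such that $G'=\{[x,g]\mid g\in G\}$.
   Context: $[x,g]=x^{-1}g^{-1}xg$; $G'$ is the derived subgroup of $G$; for a group $H$, $H^p$ denotes the subgroup generated by all $p$-th powers of elements of $H$. The action of a finite $p$-group $G$ on a normal subgroup $N$ is called uniserial if $|[N,G,\overset{i}{\ldots},G]:[N,G,\overset{i+1}{\ldots},G]|\le p$ for every $i\ge 0$ (left-normed iterated commutator subgroups, with $N$ itself for $i=0$). "Uniserial modulo $(G')^p$" means that the action of $G/(G')^p$ on $G'/(G')^p$ is uniserial, i.e. $|\gamma_i(G)(G')^p:\gamma_{i+1}(G)(G')^p|\le p$ for every $i\ge 2$, where $\gamma_i(G)$ is the $i$-th term of the lower central series. *)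

theory Defs
  imports Complex_Main "HOL-Algebra.Algebra"
begin

definition p_group :: "nat \<Rightarrow> ('a, 'b) monoid_scheme \<Rightarrow> bool" where
  "p_group p G \<longleftrightarrow> group G \<and> finite (carrier G) \<and> (\<exists>n. order G = p ^ n)"

definition commutator :: "('a, 'b) monoid_scheme \<Rightarrow> 'a \<Rightarrow> 'a \<Rightarrow> 'a" where
  "commutator G x g = inv\<^bsub>G\<^esub> x \<otimes>\<^bsub>G\<^esub> inv\<^bsub>G\<^esub> g \<otimes>\<^bsub>G\<^esub> x \<otimes>\<^bsub>G\<^esub> g"

definition commutator_subgroup :: "('a, 'b) monoid_scheme \<Rightarrow> 'a set \<Rightarrow> 'a set \<Rightarrow> 'a set" where
  "commutator_subgroup G H K = generate G {commutator G h k | h k. h \<in> H \<and> k \<in> K}"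

text \<open>The library's \<^const>\<open>derived\<close> is built from the commutators \<open>h k h\<^sup>-\<^sup>1 k\<^sup>-\<^sup>1\<close>
  instead of \<open>h\<^sup>-\<^sup>1 k\<^sup>-\<^sup>1 h k\<close>; on a subgroup both conventions give the same result.\<close>

lemma (in group) derived_eq_commutator_subgroup:
  assumes "subgroup H G"
  shows "derived G H = commutator_subgroup G H H"
proof -
  have H: "h \<in> H \<Longrightarrow> inv h \<in> H" "h \<in> H \<Longrightarrow> inv (inv h) = h" for h
    using assms by (auto simp: subgroup.m_inv_closed subgroup.mem_carrier)
  have "derived_set G H = {commutator G h k | h k. h \<in> H \<and> k \<in> H}" (is "?L = ?R")
  proof
    show "?L \<subseteq> ?R"
    proof
      fix z assume "z \<in> ?L"
      then obtain h k where hk: "h \<in> H" "k \<in> H" "z = h \<otimes> k \<otimes> inv h \<otimes> inv k" by blast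
      then have "z = commutator G (inv h) (inv k)" by (simp add: commutator_def H)
      with hk H show "z \<in> ?R" by blast
    qed
    show "?R \<subseteq> ?L"
    proof
      fix z assume "z \<in> ?R"
      then obtain h k where hk: "h \<in> H" "k \<in> H" "z = commutator G h k" by blast
      then have "z = inv h \<otimes> inv k \<otimes> inv (inv h) \<otimes> inv (inv k)"
        by (simp add: commutator_def H)
      with hk H show "z \<in> ?L" by blast
    qed
  qed
  then show ?thesis by (simp add: derived_def commutator_subgroup_def)
qed

definition power_subgroup :: "('a, 'b) monoid_scheme \<Rightarrow> 'a set \<Rightarrow> nat \<Rightarrow> 'a set" where
  "power_subgroup G H n = generate G {h [^]\<^bsub>G\<^esub> n | h. h \<in> H}"

text \<open>The index \<open>|H : K|\<close> of a subgroup \<open>K\<close> in a subgroup \<open>H\<close> of \<open>G\<close>.\<close>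

definition subgroup_index :: "('a, 'b) monoid_scheme \<Rightarrow> 'a set \<Rightarrow> 'a set \<Rightarrow> nat" where
  "subgroup_index G H K = card (rcosets\<^bsub>G\<lparr>carrier := H\<rparr>\<^esub> K)"

text \<open>The left-normed iterated commutator subgroup \<open>[N, G, \<dots>, G]\<close> with \<open>i\<close> copies of \<open>G\<close>.\<close>

primrec iterated_commutator :: "('a, 'b) monoid_scheme \<Rightarrow> 'a set \<Rightarrow> nat \<Rightarrow> 'a set" where
  "iterated_commutator G N 0 = N"
| "iterated_commutator G N (Suc i) = commutator_subgroup G (iterated_commutator G N i) (carrier G)"

text \<open>To be used for a finite \<open>p\<close>-group \<open>G\<close> and a normal subgroup \<open>N\<close> of \<open>G\<close>.\<close>

definition uniserial :: "nat \<Rightarrow> ('a, 'b) monoid_scheme \<Rightarrow> 'a set \<Rightarrow> bool" where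
  "uniserial p G N \<longleftrightarrow>
     (\<forall>i. subgroup_index G (iterated_commutator G N i) (iterated_commutator G N (Suc i)) \<le> p)"

text \<open>The action of \<open>G / K\<close> on \<open>N / K\<close> is uniserial, for normal subgroups \<open>K \<subseteq> N\<close> of \<open>G\<close>.\<close>

definition uniserial_modulo ::
    "nat \<Rightarrow> ('a, 'b) monoid_scheme \<Rightarrow> 'a set \<Rightarrow> 'a set \<Rightarrow> bool" where
  "uniserial_modulo p G N K \<longleftrightarrow> uniserial p (G Mod K) (carrier (G\<lparr>carrier := N\<rparr> Mod K))"

end

(* The element x is taken outside at most p proper subgroups: the centralizers of the factors
   \<gamma>_i N^p / \<gamma>_{i+2} N^p of N = G' (2 <= i <= d), the x with [x, G] contained in \<gamma>_3 N^p, and the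
   centralizer of \<gamma>_p modulo (\<gamma>_3 N^p)^p.  Solutions g of [x, g] = c are lifted from G/K' to G/K through central
   factors K'/K; this needs an h with [x, h] in K' but not in K.  Above N^p the choice of x
   provides h.  Below N^p take M normal, minimal with M^p not contained in K; if [x, k] is
   congruent to some c in M with c^p not in K, then h = k^p works because [x, k^p] is congruent
   to [x, k]^p.  This congruence is a case of the Hall-Petrescu formula, and its error term
   vanishes because |M : M^p| <= p^(p-1) for all normal subgroups M of G contained in N.  When
   \<gamma>_{p+1} is not contained in (\<gamma>_3 N^p)^p, the error term vanishes only for k in N, so
   [x, n] = c is solved first for c in \<gamma>_3 with n in N. *)

theory Submission
  imports Defs
begin

section \<open>Filtrations and the Hall--Petrescu congruence\<close>

text \<open>The bound d \<le> p - 1 enters twice. There are d + 1 subgroups to avoid, and a finite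
  p-group is not a union of p proper subgroups. Moreover |N : N^p| \<le> p^(p-1) puts the commutator
  of N with p - 1 copies of G inside N^p, because in a p-group every further commutator costs at
  least a factor p. The obstacle is a mismatch by one commutator. Let |M : L| = p with L^p, but not
  M^p, contained in K. For k in G the Hall-Petrescu error lies, up to p-th powers that vanish modulo
  K, in the commutator of M with p - 1 copies of G. It has to lie in K, but the index bound places
  it only in M^p. Either the stronger inclusion into L^p is true for M = N and is inherited down a
  chief series, or k must lie in N, which supplies the missing commutator. The congruence itself is
  obtained without commutator collection: m \<mapsto> b^-m a^-m (ab)^m is a polynomial sequence for
  a suitable filtration, and such sequences form a group.\<close>

definition filtration :: "('a, 'b) monoid_scheme \<Rightarrow> (nat \<Rightarrow> 'a set) \<Rightarrow> bool" where
  "filtration G H \<longleftrightarrow> (\<forall>i. subgroup (H i) G \<and> H (Suc i) \<subseteq> H i) \<and>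
     (\<forall>i j. \<forall>a \<in> H i. \<forall>b \<in> H j. commutator G a b \<in> H (i + j))"

context group
begin

lemma mult_inv_cancel:
  assumes "x \<in> carrier G" "y \<in> carrier G"
  shows "x \<otimes> (inv x \<otimes> y) = y" "inv x \<otimes> (x \<otimes> y) = y"
  using assms by (simp_all flip: m_assoc)

text \<open>Together with the simp rules for units and inverses this is the usual complete rewrite
  system for groups, so identities that hold in a free group are proved by
  \<open>simp\<close>.\<close>

lemmas group_word_simps = commutator_def m_assoc inv_mult_group mult_inv_cancel

lemma commutator_closed [simp, intro]:
  "x \<in> carrier G \<Longrightarrow> y \<in> carrier G \<Longrightarrow> commutator G x y \<in> carrier G"
  by (simp add: commutator_def)

lemma filtration_antimono:
  assumes "filtration G H" "i \<le> j"
  shows "H j \<subseteq> H i"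
  using assms(2) by (induction rule: dec_induct) (use assms(1) in \<open>auto simp: filtration_def\<close>)

lemma filtration_conj:
  assumes "filtration G H" "a \<in> H i" "g \<in> H 0"
  shows "inv g \<otimes> a \<otimes> g \<in> H i"
proof -
  have sub: "subgroup (H i) G" for i
    using assms(1) by (simp add: filtration_def)
  have "commutator G a g \<in> H (i + 0)"
    using assms unfolding filtration_def by blast
  moreover have "a \<in> carrier G" "g \<in> carrier G"
    using assms sub subgroup.mem_carrier by metis+
  moreover from this have "inv g \<otimes> a \<otimes> g = a \<otimes> commutator G a g"
    by (simp add: group_word_simps)
  ultimately show ?thesis
    using subgroup.m_closed[OF sub] assms(2) by simp
qed

text \<open>With s f = f u and s g = g v, where u and v lie one level deeper than f and g, the
  commutator [f u, g v] differs from [f, g] only by commutators involving u or v, all in level i + j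
  + 1. The lemma is stated for an arbitrary endomorphism s; the intended one is the shift of
  sequences.\<close>

lemma filtration_difference:
  assumes H: "filtration G H" and s: "s \<in> hom G G"
  shows "filtration G (\<lambda>i. {f \<in> H i. inv f \<otimes> s f \<in> H (Suc i)})"
proof -
  interpret s: group_hom G G s
    using s by (simp add: group_hom_def group_hom_axioms_def)
  have sub: "subgroup (H i) G" for i
    using H by (simp add: filtration_def)
  have carr: "x \<in> carrier G" if "x \<in> H i" for x i
    using that sub subgroup.mem_carrier by metis
  have mem: "x \<in> H i" if "x \<in> H j" "i \<le> j" for x i j
    using filtration_antimono[OF H that(2)] that(1) by blast
  have mult: "x \<otimes> y \<in> H i" if "x \<in> H i" "y \<in> H i" for x y i
    using that sub subgroup.m_closed by metis
  have invc: "inv x \<in> H i" if "x \<in> H i" for x i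
    using that sub subgroup.m_inv_closed by metis
  have comm: "commutator G x y \<in> H (i + j)" if "x \<in> H i" "y \<in> H j" for x y i j
    using H that unfolding filtration_def by blast
  have conj: "inv g \<otimes> a \<otimes> g \<in> H i" if "a \<in> H i" "g \<in> H j" for a g i j
    using filtration_conj[OF H that(1) mem[OF that(2)]] by simp
  let ?Q = "\<lambda>i. {f \<in> H i. inv f \<otimes> s f \<in> H (Suc i)}"
  have "subgroup (?Q i) G" for i
  proof (rule subgroupI)
    show "?Q i \<subseteq> carrier G" using carr by blast
    have "\<one> \<in> ?Q i"
      using sub subgroup.one_closed by fastforce
    then show "?Q i \<noteq> {}" by blast
  next
    fix f assume f: "f \<in> ?Q i"
    define u where "u = inv f \<otimes> s f"
    have "inv (inv f) \<otimes> inv u \<otimes> inv f \<in> H (Suc i)"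
      using f by (intro conj[of _ _ _ i] invc) (auto simp: u_def)
    moreover have "f \<in> carrier G"
      using f carr by blast
    then have "inv (inv f) \<otimes> s (inv f) = inv (inv f) \<otimes> inv u \<otimes> inv f"
      by (simp add: u_def group_word_simps)
    ultimately show "inv f \<in> ?Q i" using f invc by simp
  next
    fix f g assume f: "f \<in> ?Q i" and g: "g \<in> ?Q i"
    have "(inv g \<otimes> (inv f \<otimes> s f) \<otimes> g) \<otimes> (inv g \<otimes> s g) \<in> H (Suc i)"
      using f g conj mult by blast
    moreover have "f \<in> carrier G" "g \<in> carrier G"
      using f g carr by blast+
    then have "inv (f \<otimes> g) \<otimes> s (f \<otimes> g) = (inv g \<otimes> (inv f \<otimes> s f) \<otimes> g) \<otimes> (inv g \<otimes> s g)"
      by (simp add: group_word_simps)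
    ultimately show "f \<otimes> g \<in> ?Q i" using f g mult by simp
  qed
  moreover have "?Q (Suc i) \<subseteq> ?Q i" for i
    using mem by auto
  moreover have "commutator G f g \<in> ?Q (i + j)" if f: "f \<in> ?Q i" and g: "g \<in> ?Q j" for f g i j
  proof -
    define u v w where "u = inv f \<otimes> s f" and "v = inv g \<otimes> s g" and "w = commutator G f g"
    have u: "u \<in> H (Suc i)" and v: "v \<in> H (Suc j)" and w: "w \<in> H (i + j)"
      using f g comm by (auto simp: u_def v_def w_def)
    have fg: "f \<in> H i" "g \<in> H j" using f g by auto
    have c: "f \<in> carrier G" "g \<in> carrier G" "u \<in> carrier G" "v \<in> carrier G" "w \<in> carrier G"
      using u v w fg carr by blast+
    have sfg: "s f = f \<otimes> u" "s g = g \<otimes> v"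
      using c by (simp_all add: u_def v_def mult_inv_cancel)
    \<comment> \<open>These are the factors in [f u, g v] = A (w conjugated by u v) B, and
      conjugating w by u v gives w [w, u v].\<close>
    define A where "A = (inv u \<otimes> commutator G f v \<otimes> u) \<otimes> commutator G u v"
    define B where "B = inv v \<otimes> commutator G u g \<otimes> v"
    have "commutator G u v \<in> H (Suc (i + j))"
      by (rule mem[OF comm[OF u v]]) simp
    then have A: "A \<in> H (Suc (i + j))"
      unfolding A_def using conj[OF _ u] comm[OF fg(1) v] mult by simp
    have B: "B \<in> H (Suc (i + j))"
      unfolding B_def using conj[OF _ v] comm[OF u fg(2)] by simp
    have "u \<otimes> v \<in> H 1"
      using mem[OF u, of 1] mem[OF v, of 1] mult by simp
    then have "commutator G w (u \<otimes> v) \<in> H (Suc (i + j))"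
      using comm[OF w] by fastforce
    then have "(inv w \<otimes> A \<otimes> w) \<otimes> commutator G w (u \<otimes> v) \<otimes> B \<in> H (Suc (i + j))"
      using A B conj[OF A w] mult by simp
    moreover have "s w = commutator G (s f) (s g)"
      using c by (simp add: w_def commutator_def)
    then have "inv w \<otimes> s w = (inv w \<otimes> A \<otimes> w) \<otimes> commutator G w (u \<otimes> v) \<otimes> B"
      using c unfolding sfg A_def B_def by (simp add: w_def group_word_simps)
    ultimately show ?thesis
      using w by (simp add: w_def)
  qed
  ultimately show ?thesis
    unfolding filtration_def by blast
qed

end

text \<open>Unfolded, \<open>f \<in> polynomial_seq G H n i\<close> says that the \<open>k\<close>-th difference of \<open>f\<close> at \<open>0\<close> lies
  in \<open>H (k + i)\<close> for all \<open>k \<le> n\<close>, where the difference of \<open>f\<close> is \<open>m \<mapsto> f(m)\<^sup>-\<^sup>1 f(m + 1)\<close>.\<close>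

primrec polynomial_seq ::
    "('a, 'b) monoid_scheme \<Rightarrow> (nat \<Rightarrow> 'a set) \<Rightarrow> nat \<Rightarrow> nat \<Rightarrow> (nat \<Rightarrow> 'a) set" where
  "polynomial_seq G H 0 i = {f. (\<forall>m. f m \<in> carrier G) \<and> f 0 \<in> H i}"
| "polynomial_seq G H (Suc n) i =
     {f \<in> polynomial_seq G H n i. (\<lambda>m. inv\<^bsub>G\<^esub> f m \<otimes>\<^bsub>G\<^esub> f (Suc m)) \<in> polynomial_seq G H n (Suc i)}"

section \<open>Polynomial sequences and the Hall-Petrescu congruence\<close>

context group
begin

lemma inv_product_group_UNIV:
  "f \<in> carrier (product_group UNIV (\<lambda>_. G)) \<Longrightarrow>
    inv\<^bsub>product_group UNIV (\<lambda>_. G)\<^esub> f = (\<lambda>m. inv f m)"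
  using inv_product_group[of f UNIV "\<lambda>_. G"] by (simp add: restrict_UNIV)

text \<open>A form of the Lazard-Leibman theorem. The shift is an endomorphism of the group of all
  sequences, and passing from n to n + 1 is one application of \<open>filtration_difference\<close>.
  The aim is closure under products and inverses, but its inductive step uses the commutator
  condition, so the whole filtration is carried along.\<close>

lemma filtration_polynomial_seq:
  assumes "filtration G H"
  shows "filtration (product_group UNIV (\<lambda>_. G)) (polynomial_seq G H n)"
proof -
  let ?F = "product_group (UNIV :: nat set) (\<lambda>_. G)"
  interpret F: group ?F
    by simp
  note inv = inv_product_group_UNIV
  have carr: "f \<in> carrier ?F \<longleftrightarrow> (\<forall>m. f m \<in> carrier G)" for f
    by (auto simp: PiE_def)
  show ?thesis
  proof (induction n)
    case 0
    have sub: "subgroup (H i) G" for i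
      using assms by (simp add: filtration_def)
    have "subgroup (polynomial_seq G H 0 i) ?F" for i
    proof (rule F.subgroupI)
      have "(\<lambda>m. \<one>) \<in> polynomial_seq G H 0 i"
        using subgroup.one_closed[OF sub] by simp
      then show "polynomial_seq G H 0 i \<noteq> {}" by blast
    qed (use inv carr sub in \<open>auto simp: subgroup.m_closed subgroup.m_inv_closed\<close>)
    moreover have "commutator ?F f g = (\<lambda>m. commutator G (f m) (g m))"
      if "f \<in> carrier ?F" "g \<in> carrier ?F" for f g
      using that by (auto simp: commutator_def inv)
    ultimately show ?case
      using assms carr unfolding filtration_def by auto
  next
    case (Suc n)
    have "(\<lambda>f m. f (Suc m)) \<in> hom ?F ?F"
      by (auto simp: hom_def)
    from F.filtration_difference[OF Suc this]
    have "filtration ?F (\<lambda>i. {f \<in> polynomial_seq G H n i.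
        inv\<^bsub>?F\<^esub> f \<otimes>\<^bsub>?F\<^esub> (\<lambda>m. f (Suc m)) \<in> polynomial_seq G H n (Suc i)})" .
    moreover have "polynomial_seq G H n i \<subseteq> carrier ?F" for i
      using Suc unfolding filtration_def subgroup_def by blast
    then have "polynomial_seq G H (Suc n) = (\<lambda>i. {f \<in> polynomial_seq G H n i.
        inv\<^bsub>?F\<^esub> f \<otimes>\<^bsub>?F\<^esub> (\<lambda>m. f (Suc m)) \<in> polynomial_seq G H n (Suc i)})"
      by (auto simp: inv restrict_UNIV fun_eq_iff subset_iff cong: conj_cong)
    ultimately show ?case by simp
  qed
qed

lemma polynomial_seq_mult:
  assumes "filtration G H" "f \<in> polynomial_seq G H n i" "g \<in> polynomial_seq G H n i"
  shows "(\<lambda>m. f m \<otimes> g m) \<in> polynomial_seq G H n i"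
  using subgroup.m_closed[of "polynomial_seq G H n i" "product_group UNIV (\<lambda>_. G)" f g]
    filtration_polynomial_seq[OF assms(1), of n] assms(2,3)
  by (simp add: filtration_def restrict_UNIV)

lemma polynomial_seq_inv:
  assumes "filtration G H" "f \<in> polynomial_seq G H n i"
  shows "(\<lambda>m. inv f m) \<in> polynomial_seq G H n i"
proof -
  let ?F = "product_group (UNIV :: nat set) (\<lambda>_. G)"
  have sub: "subgroup (polynomial_seq G H n i) ?F"
    using filtration_polynomial_seq[OF assms(1)] by (simp add: filtration_def)
  then have "f \<in> carrier ?F"
    using assms(2) by (rule subgroup.mem_carrier)
  from inv_product_group_UNIV[OF this] show ?thesis
    using subgroup.m_inv_closed[OF sub assms(2)] by simp
qed

text \<open>By Pascal's rule the difference of c^(m choose k) is c^(m choose (k - 1)): k drops by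
  one while the level i rises by one, so k + i is unchanged.\<close>

lemma polynomial_seq_choose:
  assumes "filtration G H" "c \<in> H (k + i)"
  shows "(\<lambda>m. c [^] (m choose k)) \<in> polynomial_seq G H n i"
  using assms(2)
proof (induction n arbitrary: k i)
  case 0
  have sub: "subgroup (H i) G" for i
    using assms(1) by (simp add: filtration_def)
  have "c \<in> carrier G" "c \<in> H i"
    using 0 subgroup.mem_carrier[OF sub] filtration_antimono[OF assms(1), of i "k + i"] by auto
  then show ?case
    by (cases k) (auto simp: subgroup.one_closed[OF sub])
next
  case (Suc n)
  have c: "c \<in> carrier G"
    using Suc.prems assms(1) unfolding filtration_def by (meson subgroup.mem_carrier)
  have "(\<lambda>m. inv (c [^] (m choose k)) \<otimes> c [^] (Suc m choose k)) \<in> polynomial_seq G H n (Suc i)"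
  proof (cases k)
    case 0
    have sub: "subgroup (polynomial_seq G H n (Suc i)) (product_group UNIV (\<lambda>_. G))"
      using filtration_polynomial_seq[OF assms(1), of n] by (simp add: filtration_def)
    from subgroup.one_closed[OF this] show ?thesis
      using 0 c by (simp add: restrict_UNIV)
  next
    case (Suc k')
    have "inv (c [^] (m choose k)) \<otimes> c [^] (Suc m choose k) = c [^] (m choose k')" for m
      using c Suc by (simp add: add.commute[of "m choose k'"] mult_inv_cancel flip: nat_pow_mult)
    then show ?thesis
      using Suc.IH[of k' "Suc i"] Suc.prems Suc by simp
  qed
  then show ?case
    using Suc by simp
qed

text \<open>If f is trivial below n, its difference is trivial below n - 1 and takes the value f(n)
  at n - 1. Hence the n-th difference at 0 is f(n).\<close>

lemma polynomial_seq_first_value: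
  assumes "filtration G H" "f \<in> polynomial_seq G H n i" "\<And>m. m < n \<Longrightarrow> f m = \<one>"
  shows "f n \<in> H (n + i)"
  using assms(2,3)
proof (induction n arbitrary: f i)
  case (Suc n)
  define g where "g m = inv f m \<otimes> f (Suc m)" for m
  have "g n \<in> H (n + Suc i)"
  proof (rule Suc.IH)
    show "g \<in> polynomial_seq G H n (Suc i)"
      using Suc.prems by (simp add: g_def[abs_def])
    show "g m = \<one>" if "m < n" for m
      using that Suc.prems(2)[of m] Suc.prems(2)[of "Suc m"] by (simp add: g_def)
  qed
  moreover have "f (Suc n) \<in> carrier G"
  proof -
    have "polynomial_seq G H k i \<subseteq> {f. \<forall>m. f m \<in> carrier G}" for k i
      by (induction k arbitrary: i) auto
    then show ?thesis using Suc.prems by blast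
  qed
  then have "g n = f (Suc n)"
    using Suc.prems(2)[of n] by (simp add: g_def)
  ultimately show ?case by simp
qed simp

lemma polynomial_seq_antimono:
  "k \<le> n \<Longrightarrow> polynomial_seq G H n i \<subseteq> polynomial_seq G H k i"
  by (induction rule: dec_induct) auto

text \<open>The values of a polynomial sequence are removed one after the other by dividing by
  \<open>c [^] (m choose k)\<close>; at \<open>m = p\<close> this changes nothing modulo \<open>K\<close>, since \<open>p\<close> divides
  \<open>p choose k\<close> for \<open>0 < k < p\<close>.\<close>

lemma polynomial_seq_prime_value:
  assumes H: "filtration G H" and p: "Factorial_Ring.prime p" and K: "subgroup K G"
    and Hp: "H p \<subseteq> K" and H2: "\<And>h. h \<in> H 2 \<Longrightarrow> h [^] p \<in> K"
    and f: "f \<in> polynomial_seq G H p 0"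
    and one: "\<And>m. m < k \<Longrightarrow> f m = \<one>" and k: "2 \<le> k" "k \<le> p"
  shows "f p \<in> K"
  using k(2,1) f one
proof (induction arbitrary: f rule: inc_induct)
  case base
  then show ?case
    using polynomial_seq_first_value[OF H, of f p 0] Hp by auto
next
  case (step k)
  define c where "c = f k"
  have "c \<in> H (k + 0)"
    unfolding c_def using step polynomial_seq_antimono[of k p H 0]
    by (intro polynomial_seq_first_value[OF H]) auto
  then have cH: "c \<in> H k" by simp
  then have c: "c \<in> carrier G"
    using H unfolding filtration_def by (meson subgroup.mem_carrier)
  define g where "g m = f m \<otimes> inv (c [^] (m choose k))" for m
  have g: "g \<in> polynomial_seq G H p 0"
    unfolding g_def using step.prems(2) cH
    by (intro polynomial_seq_mult[OF H] polynomial_seq_inv[OF H] polynomial_seq_choose[OF H]) auto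
  have "g m = \<one>" if "m < Suc k" for m
    using that step.prems(3)[of m] c
    by (cases "m = k") (auto simp: g_def c_def binomial_eq_0)
  then have "g p \<in> K"
    using step.IH[of g] step.prems(1) g by simp
  moreover have cK: "c [^] (p choose k) \<in> K"
  proof -
    have "p dvd (p choose k)"
      using p step by (intro dvd_choose_prime) auto
    then obtain j where "p choose k = p * j" by blast
    then have "c [^] (p choose k) = (c [^] p) [^] j"
      using c by (simp add: nat_pow_pow)
    moreover have "c [^] p \<in> K"
      using H2 cH filtration_antimono[OF H step.prems(1)] by blast
    then have "(c [^] p) [^] j \<in> K" for j :: nat
      using K by (induction j) (auto simp: subgroup.one_closed subgroup.m_closed)
    ultimately show ?thesis by simp
  qed
  moreover have "f p \<in> carrier G"
    using step.prems(2) polynomial_seq_antimono[of 0 p H 0] by auto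
  then have "f p = g p \<otimes> c [^] (p choose k)"
    using c by (simp add: g_def m_assoc)
  ultimately show ?case
    using subgroup.m_closed[OF K] by metis
qed

text \<open>Powers m \<mapsto> c^m with c in \<open>H 1\<close> are polynomial (exponent m choose
  1), hence so is b^-m a^-m (ab)^m. It is trivial at m = 0 and m = 1, so the corrections start at k
  = 2, where p-th powers already lie in K.\<close>

theorem Hall_Petrescu_mod:
  assumes H: "filtration G H" and H01: "H 0 = H 1" and p: "Factorial_Ring.prime p"
    and K: "subgroup K G"
    and Hp: "H p \<subseteq> K" and H2: "\<And>h. h \<in> H 2 \<Longrightarrow> h [^] p \<in> K"
    and a: "a \<in> H 1" and b: "b \<in> H 1"
  shows "inv (b [^] p) \<otimes> inv (a [^] p) \<otimes> (a \<otimes> b) [^] p \<in> K"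
proof -
  have sub: "subgroup (H 1) G"
    using H by (simp add: filtration_def)
  have pow: "(\<lambda>m. c [^] m) \<in> polynomial_seq G H p 0" if "c \<in> H 1" for c
    using polynomial_seq_choose[OF H, of c 1 0] that by simp
  define f where "f m = inv (b [^] m) \<otimes> inv (a [^] m) \<otimes> (a \<otimes> b) [^] m" for m :: nat
  have "f \<in> polynomial_seq G H p 0"
    unfolding f_def using a b subgroup.m_closed[OF sub]
    by (intro polynomial_seq_mult[OF H] polynomial_seq_inv[OF H] pow) auto
  moreover have "f m = \<one>" if "m < 2" for m
  proof -
    have "m = 0 \<or> m = 1" using that by auto
    then show ?thesis
      using subgroup.mem_carrier[OF sub a] subgroup.mem_carrier[OF sub b]
      by (auto simp: f_def group_word_simps)
  qed
  ultimately have "f p \<in> K"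
    using polynomial_seq_prime_value[OF H p K Hp H2, of f 2] p by (simp add: prime_ge_2_nat)
  then show ?thesis by (simp add: f_def)
qed

end

section \<open>Commutator calculus modulo a normal subgroup\<close>

text \<open>For normal Q, \<open>centralizer_mod G (carrier G) Q\<close> is the preimage of the
  centre of G/Q. Centrality modulo Q is thus expressed inside G, without a quotient group.\<close>

definition centralizer_mod :: "('a, 'b) monoid_scheme \<Rightarrow> 'a set \<Rightarrow> 'a set \<Rightarrow> 'a set" where
  "centralizer_mod G T Q = {x \<in> carrier G. \<forall>t \<in> T. commutator G x t \<in> Q}"

text \<open>For normal Q this is the preimage of the n-th term of the upper central series of
  G/Q.\<close>

primrec upper_central_mod :: "('a, 'b) monoid_scheme \<Rightarrow> 'a set \<Rightarrow> nat \<Rightarrow> 'a set" where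
  "upper_central_mod G Q 0 = Q"
| "upper_central_mod G Q (Suc n) = centralizer_mod G (carrier G) (upper_central_mod G Q n)"

context group
begin

lemma normal_conj:
  assumes "N \<lhd> G" "h \<in> N" "x \<in> carrier G"
  shows "x \<otimes> h \<otimes> inv x \<in> N" "inv x \<otimes> h \<otimes> x \<in> N"
  using normal.inv_op_closed2[OF assms(1,3,2)] normal.inv_op_closed1[OF assms(1,3,2)] by simp_all

lemma normal_carrier: "N \<lhd> G \<Longrightarrow> h \<in> N \<Longrightarrow> h \<in> carrier G"
  by (rule subgroup.mem_carrier[OF normal_imp_subgroup])

lemma inv_commutator:
  "x \<in> carrier G \<Longrightarrow> y \<in> carrier G \<Longrightarrow> inv (commutator G x y) = commutator G y x"
  by (simp add: group_word_simps)

lemma commutator_swap_mem: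
  assumes "subgroup Q G" "x \<in> carrier G" "y \<in> carrier G" "commutator G x y \<in> Q"
  shows "commutator G y x \<in> Q"
  using subgroup.m_inv_closed[OF assms(1,4)] assms(2,3) by (simp add: inv_commutator)

lemma conj_commutator:
  assumes "x \<in> carrier G" "y \<in> carrier G" "g \<in> carrier G"
  shows "g \<otimes> commutator G x y \<otimes> inv g =
    commutator G (g \<otimes> x \<otimes> inv g) (g \<otimes> y \<otimes> inv g)"
  using assms by (simp add: group_word_simps)

lemma conj_nat_pow:
  assumes "x \<in> carrier G" "g \<in> carrier G"
  shows "(g \<otimes> x \<otimes> inv g) [^] n = g \<otimes> x [^] (n :: nat) \<otimes> inv g"
  using assms by (induction n) (simp_all add: m_assoc mult_inv_cancel)

lemma subgroup_nat_pow_closed: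
  "subgroup H G \<Longrightarrow> h \<in> H \<Longrightarrow> h [^] (n :: nat) \<in> H"
  by (induction n) (auto simp: subgroup.one_closed subgroup.m_closed)

lemma commutator_mem_left:
  assumes "N \<lhd> G" "x \<in> N" "y \<in> carrier G"
  shows "commutator G x y \<in> N"
proof -
  have "subgroup N G" using assms by (simp add: normal_imp_subgroup)
  then have "inv x \<otimes> (inv y \<otimes> x \<otimes> y) \<in> N"
    by (intro subgroup.m_closed subgroup.m_inv_closed normal_conj assms)
  moreover have "x \<in> carrier G"
    using normal_carrier assms by blast
  ultimately show ?thesis
    using assms(3) by (simp add: group_word_simps)
qed

lemma subgroup_centralizer_mod:
  assumes Q: "Q \<lhd> G" and T: "T \<subseteq> carrier G"
  shows "subgroup (centralizer_mod G T Q) G"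
proof (rule subgroupI)
  have Qs: "subgroup Q G" using Q by (rule normal_imp_subgroup)
  have "\<one> \<in> centralizer_mod G T Q"
    using T subgroup.one_closed[OF Qs] by (auto simp: centralizer_mod_def commutator_def)
  then show "centralizer_mod G T Q \<noteq> {}" by blast
  show "inv x \<in> centralizer_mod G T Q" if x: "x \<in> centralizer_mod G T Q" for x
  proof -
    have "commutator G (inv x) t \<in> Q" if t: "t \<in> T" for t
    proof -
      have c: "x \<in> carrier G" "t \<in> carrier G" "commutator G x t \<in> Q"
        using x t T by (auto simp: centralizer_mod_def)
      then have "x \<otimes> inv (commutator G x t) \<otimes> inv x \<in> Q"
        using Q Qs by (intro normal_conj) (auto simp: subgroup.m_inv_closed)
      then show ?thesis using c by (simp add: group_word_simps)
    qed
    then show ?thesis using x by (auto simp: centralizer_mod_def)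
  qed
  show "x \<otimes> y \<in> centralizer_mod G T Q"
    if x: "x \<in> centralizer_mod G T Q" and y: "y \<in> centralizer_mod G T Q" for x y
  proof -
    have "commutator G (x \<otimes> y) t \<in> Q" if t: "t \<in> T" for t
    proof -
      have c: "x \<in> carrier G" "y \<in> carrier G" "t \<in> carrier G"
        "commutator G x t \<in> Q" "commutator G y t \<in> Q"
        using x y t T by (auto simp: centralizer_mod_def)
      then have "inv y \<otimes> commutator G x t \<otimes> y \<otimes> commutator G y t \<in> Q"
        using Q Qs by (intro subgroup.m_closed[OF Qs] normal_conj) auto
      then show ?thesis using c by (simp add: group_word_simps)
    qed
    then show ?thesis using x y by (auto simp: centralizer_mod_def)
  qed
qed (auto simp: centralizer_mod_def)

lemma normal_centralizer_mod:
  assumes Q: "Q \<lhd> G"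
  shows "centralizer_mod G (carrier G) Q \<lhd> G"
proof (rule normal_invI)
  show "subgroup (centralizer_mod G (carrier G) Q) G"
    using subgroup_centralizer_mod[OF Q] by simp
  fix g h assume g: "g \<in> carrier G" and h: "h \<in> centralizer_mod G (carrier G) Q"
  have "commutator G (g \<otimes> h \<otimes> inv g) t \<in> Q" if t: "t \<in> carrier G" for t
  proof -
    have c: "h \<in> carrier G" using h by (simp add: centralizer_mod_def)
    have "g \<otimes> commutator G h (inv g \<otimes> t \<otimes> g) \<otimes> inv g \<in> Q"
      using h g t Q by (intro normal_conj) (auto simp: centralizer_mod_def)
    then show ?thesis using c g t by (simp add: group_word_simps)
  qed
  then show "g \<otimes> h \<otimes> inv g \<in> centralizer_mod G (carrier G) Q"
    using g h by (auto simp: centralizer_mod_def)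
qed

lemma centralizer_mod_incl:
  "Q \<lhd> G \<Longrightarrow> Q \<subseteq> centralizer_mod G (carrier G) Q"
  using commutator_mem_left normal_carrier by (auto simp: centralizer_mod_def)

lemma normal_upper_central_mod: "Q \<lhd> G \<Longrightarrow> upper_central_mod G Q n \<lhd> G"
  by (induction n) (auto simp: normal_centralizer_mod)

section \<open>Commutator subgroups and iterated commutators\<close>

lemma commutator_set_carrier:
  "H \<subseteq> carrier G \<Longrightarrow> K \<subseteq> carrier G \<Longrightarrow>
    {commutator G h k | h k. h \<in> H \<and> k \<in> K} \<subseteq> carrier G"
  by auto

lemma commutator_subgroup_memI:
  "h \<in> H \<Longrightarrow> k \<in> K \<Longrightarrow> commutator G h k \<in> commutator_subgroup G H K"
  unfolding commutator_subgroup_def by (rule generate.incl) blast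

lemma commutator_subgroup_leI:
  assumes "subgroup Q G" "\<And>h k. h \<in> H \<Longrightarrow> k \<in> K \<Longrightarrow> commutator G h k \<in> Q"
  shows "commutator_subgroup G H K \<subseteq> Q"
  unfolding commutator_subgroup_def using assms by (intro generate_subgroup_incl) auto

lemma normal_commutator_subgroup:
  assumes "H \<lhd> G" "K \<lhd> G"
  shows "commutator_subgroup G H K \<lhd> G"
  unfolding commutator_subgroup_def
proof (rule normal_generateI)
  show "{commutator G h k | h k. h \<in> H \<and> k \<in> K} \<subseteq> carrier G"
    using assms normal_carrier by blast
next
  fix x g assume "x \<in> {commutator G h k | h k. h \<in> H \<and> k \<in> K}" and g: "g \<in> carrier G"
  then obtain h k where x: "x = commutator G h k" "h \<in> H" "k \<in> K" by blast
  then have "g \<otimes> x \<otimes> inv g = commutator G (g \<otimes> h \<otimes> inv g) (g \<otimes> k \<otimes> inv g)"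
    using g assms normal_carrier conj_commutator by metis
  then show "g \<otimes> x \<otimes> inv g \<in> {commutator G h k | h k. h \<in> H \<and> k \<in> K}"
    using x g assms normal_conj by blast
qed

lemma commutator_subgroup_incl_left:
  "N \<lhd> G \<Longrightarrow> commutator_subgroup G N (carrier G) \<subseteq> N"
  by (intro commutator_subgroup_leI normal_imp_subgroup commutator_mem_left)

lemma normal_iterated_commutator: "N \<lhd> G \<Longrightarrow> iterated_commutator G N n \<lhd> G"
  by (induction n) (auto intro: normal_commutator_subgroup normal_self)

lemma iterated_commutator_memI:
  "x \<in> iterated_commutator G N n \<Longrightarrow> g \<in> carrier G \<Longrightarrow>
    commutator G x g \<in> iterated_commutator G N (Suc n)"
  by (simp add: commutator_subgroup_memI)

lemma iterated_commutator_antimono: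
  assumes "N \<lhd> G" "m \<le> n"
  shows "iterated_commutator G N n \<subseteq> iterated_commutator G N m"
  using assms(2)
proof (induction rule: dec_induct)
  case (step n)
  then show ?case
    using commutator_subgroup_incl_left[OF normal_iterated_commutator[OF assms(1), of n]] by auto
qed simp

lemma iterated_commutator_add:
  "iterated_commutator G (iterated_commutator G N m) n = iterated_commutator G N (m + n)"
  by (induction n) auto

lemma commutator_subgroup_subset_iff:
  assumes "N \<subseteq> carrier G" "Q \<lhd> G"
  shows "commutator_subgroup G N (carrier G) \<subseteq> Q \<longleftrightarrow> N \<subseteq> centralizer_mod G (carrier G) Q"
  using assms commutator_subgroup_memI[of _ N _ "carrier G"]
    commutator_subgroup_leI[OF normal_imp_subgroup[OF assms(2)]]
  unfolding centralizer_mod_def by blast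

text \<open>Commuting with G and taking the centre modulo Q are adjoint. The right-hand side
  collects all N with the property in one subgroup, so that the property passes to products of such
  N.\<close>

lemma iterated_commutator_subset_iff:
  assumes "N \<lhd> G" "Q \<lhd> G"
  shows "iterated_commutator G N n \<subseteq> Q \<longleftrightarrow> N \<subseteq> upper_central_mod G Q n"
proof -
  \<comment> \<open>m has to vary: moving one copy of G to the right-hand side uses the statement
    for m + 1.\<close>
  have "iterated_commutator G N (m + n) \<subseteq> Q \<longleftrightarrow>
      iterated_commutator G N m \<subseteq> upper_central_mod G Q n" for m
  proof (induction n arbitrary: m)
    case (Suc n)
    have "iterated_commutator G N (m + Suc n) \<subseteq> Q \<longleftrightarrow>
        iterated_commutator G N (Suc m) \<subseteq> upper_central_mod G Q n"
      using Suc[of "Suc m"] by simp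
    also have "\<dots> \<longleftrightarrow> iterated_commutator G N m \<subseteq> upper_central_mod G Q (Suc n)"
      using commutator_subgroup_subset_iff[OF _ normal_upper_central_mod[OF assms(2), of n],
          of "iterated_commutator G N m"] normal_iterated_commutator[OF assms(1), of m]
      by (simp add: normal_imp_subgroup subgroup.subset)
    finally show ?case .
  qed simp
  from this[of 0] show ?thesis by simp
qed

lemma iterated_commutator_mono:
  assumes "N \<lhd> G" "Y \<lhd> G" "N \<subseteq> Y"
  shows "iterated_commutator G N n \<subseteq> iterated_commutator G Y n"
  using assms iterated_commutator_subset_iff[OF _ normal_iterated_commutator[OF assms(2)]]
  by (meson order_refl subset_trans)

text \<open>The three subgroups lemma, in the form of the Hall--Witt identity, gives the
  induction step. Note the shift of the index: \<open>iterated_commutator G (carrier G) j\<close> is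
  \<open>\<gamma>\<^sub>j\<^sub>+\<^sub>1(G)\<close>.\<close>

lemma commutator_lower_central:
  assumes N: "N \<lhd> G"
  shows "a \<in> iterated_commutator G N i \<Longrightarrow> b \<in> iterated_commutator G (carrier G) j \<Longrightarrow>
    commutator G a b \<in> iterated_commutator G N (i + j + 1)"
proof (induction j arbitrary: a b i)
  case 0
  then show ?case using iterated_commutator_memI[of a N i b] by simp
next
  case (Suc j)
  let ?N = "iterated_commutator G N" and ?L = "iterated_commutator G (carrier G)"
  let ?Q = "?N (i + j + 2)"
  have nX: "?N m \<lhd> G" and nL: "?L m \<lhd> G" for m
    using N normal_self normal_iterated_commutator by auto
  have sX: "subgroup (?N m) G" and sL: "subgroup (?L m) G" for m
    using nX nL by (simp_all add: normal_imp_subgroup)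
  have cX: "x \<in> carrier G" if "x \<in> ?N m" for x m
    using that nX normal_carrier by blast
  have cL: "x \<in> carrier G" if "x \<in> ?L m" for x m
    using that nL normal_carrier by blast
  have "commutator G (commutator G u g) a \<in> ?Q"
    if a: "a \<in> ?N i" and u: "u \<in> ?L j" and g: "g \<in> carrier G" for a u g
  proof -
    have ac: "a \<in> carrier G" and uc: "u \<in> carrier G" using a u cX cL by auto
    have "commutator G a (inv u) \<in> ?N (i + j + 1)"
      using Suc.IH[OF a] u sL subgroup.m_inv_closed by metis
    then have 1: "commutator G (commutator G a (inv u)) (inv g) \<in> ?Q"
      using iterated_commutator_memI[of _ N "i + j + 1" "inv g"] g by simp
    have "commutator G (inv a) (inv g) \<in> ?N (Suc i)"
      using iterated_commutator_memI[of "inv a" N i "inv g"] g subgroup.m_inv_closed[OF sX a] by simp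
    then have "commutator G (inv g) (inv a) \<in> ?N (Suc i)"
      using ac g by (intro commutator_swap_mem[OF sX, of "inv a" "inv g"]) simp_all
    from Suc.IH[OF this u] have 2: "commutator G (commutator G (inv g) (inv a)) u \<in> ?Q"
      by simp
    \<comment> \<open>Hall-Witt identity: D, C and the conjugate g [[u, g], a] g^-1 multiply to the
      identity, in this order.\<close>
    define C where "C = (inv u \<otimes> commutator G (commutator G a (inv u)) (inv g) \<otimes> u)"
    define D where "D = (inv a \<otimes> commutator G (commutator G (inv g) (inv a)) u \<otimes> a)"
    have CD: "C \<in> ?Q" "D \<in> ?Q"
      unfolding C_def D_def by (rule normal_conj(2)[OF nX 1 uc] normal_conj(2)[OF nX 2 ac])+
    have "inv g \<otimes> inv (D \<otimes> C) \<otimes> g \<in> ?Q"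
      by (intro normal_conj(2) nX subgroup.m_inv_closed[OF sX] subgroup.m_closed[OF sX] CD g)
    moreover have "inv g \<otimes> inv (D \<otimes> C) \<otimes> g = commutator G (commutator G u g) a"
      using ac uc g by (simp add: C_def D_def group_word_simps)
    ultimately show ?thesis by simp
  qed
  then have "?L (Suc j) \<subseteq> centralizer_mod G (?N i) ?Q"
    unfolding iterated_commutator.simps
    using cL cX by (intro commutator_subgroup_leI subgroup_centralizer_mod nX)
      (auto simp: centralizer_mod_def)
  then have "commutator G b a \<in> ?Q"
    using Suc.prems by (auto simp: centralizer_mod_def)
  then have "commutator G a b \<in> ?Q"
    using commutator_swap_mem[OF sX] Suc.prems cX cL by blast
  then show ?case by simp
qed

section \<open>Power subgroups and products of normal subgroups\<close>

lemma power_subgroup_memI: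
  "h \<in> H \<Longrightarrow> h [^] n \<in> power_subgroup G H n"
  unfolding power_subgroup_def by (rule generate.incl) blast

lemma power_subgroup_leI:
  assumes "subgroup Q G" "\<And>h. h \<in> H \<Longrightarrow> h [^] n \<in> Q"
  shows "power_subgroup G H n \<subseteq> Q"
  unfolding power_subgroup_def using assms by (intro generate_subgroup_incl) auto

lemma normal_power_subgroup:
  assumes "H \<lhd> G"
  shows "power_subgroup G H n \<lhd> G"
  unfolding power_subgroup_def
proof (rule normal_generateI)
  show "{h [^] n | h. h \<in> H} \<subseteq> carrier G"
    using assms normal_carrier by blast
next
  fix x g assume "x \<in> {h [^] n | h. h \<in> H}" and g: "g \<in> carrier G"
  then obtain h where x: "x = h [^] n" "h \<in> H" by blast
  then have "g \<otimes> x \<otimes> inv g = (g \<otimes> h \<otimes> inv g) [^] n"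
    using g normal_carrier[OF assms] conj_nat_pow by metis
  then show "g \<otimes> x \<otimes> inv g \<in> {h [^] n | h. h \<in> H}"
    using x g assms normal_conj by blast
qed

lemma power_subgroup_incl: "subgroup H G \<Longrightarrow> power_subgroup G H n \<subseteq> H"
  using power_subgroup_leI subgroup_nat_pow_closed by blast

lemma power_subgroup_mono:
  assumes "H \<lhd> G" "K \<subseteq> H"
  shows "power_subgroup G K n \<subseteq> power_subgroup G H n"
  using assms(2) power_subgroup_memI[of _ H]
  by (intro power_subgroup_leI normal_imp_subgroup normal_power_subgroup assms(1)) auto

lemma normal_set_mult:
  assumes "H \<lhd> G" "K \<lhd> G"
  shows "H <#> K \<lhd> G"
proof (rule normal_invI)
  show "subgroup (H <#> K) G"
    using assms by (intro mult_norm_subgroup normal_imp_subgroup)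
  fix g x assume g: "g \<in> carrier G" and "x \<in> H <#> K"
  then obtain h k where x: "x = h \<otimes> k" "h \<in> H" "k \<in> K" by (auto simp: set_mult_def)
  moreover have "h \<in> carrier G" "k \<in> carrier G"
    using x assms normal_carrier by blast+
  ultimately have "g \<otimes> x \<otimes> inv g = (g \<otimes> h \<otimes> inv g) \<otimes> (g \<otimes> k \<otimes> inv g)"
    using g by (simp add: m_assoc mult_inv_cancel)
  moreover have "g \<otimes> h \<otimes> inv g \<in> H" "g \<otimes> k \<otimes> inv g \<in> K"
    using x g normal_conj(1)[OF assms(1)] normal_conj(1)[OF assms(2)] by simp_all
  ultimately show "g \<otimes> x \<otimes> inv g \<in> H <#> K"
    unfolding set_mult_def by blast
qed

lemma set_mult_upper:
  assumes "subgroup H G" "subgroup K G"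
  shows "H \<subseteq> H <#> K" "K \<subseteq> H <#> K"
proof -
  have "h \<otimes> \<one> \<in> H <#> K" if "h \<in> H" for h
    using that subgroup.one_closed[OF assms(2)] unfolding set_mult_def by blast
  then show "H \<subseteq> H <#> K"
    using subgroup.mem_carrier[OF assms(1)] by auto
  have "\<one> \<otimes> k \<in> H <#> K" if "k \<in> K" for k
    using that subgroup.one_closed[OF assms(1)] unfolding set_mult_def by blast
  then show "K \<subseteq> H <#> K"
    using subgroup.mem_carrier[OF assms(2)] by auto
qed

lemma set_mult_least:
  assumes "subgroup Q G" "H \<subseteq> Q" "K \<subseteq> Q"
  shows "H <#> K \<subseteq> Q"
  using subgroup.m_closed[OF assms(1)] assms(2,3) by (auto simp: set_mult_def)

end

section \<open>Normal subgroups of finite p-groups\<close>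

lemma (in group_hom) hom_commutator:
  "x \<in> carrier G \<Longrightarrow> y \<in> carrier G \<Longrightarrow>
    h (commutator G x y) = commutator H (h x) (h y)"
  by (simp add: commutator_def)

lemma (in group) group_hom_FactGroup:
  assumes "A \<lhd> G"
  shows "group_hom G (G Mod A) (\<lambda>a. A #> a)"
  using normal.factorgroup_is_group[OF assms] normal.r_coset_hom_Mod[OF assms]
  by (simp add: group_hom_def group_hom_axioms_def is_group)

locale finite_p_group = group G for G (structure) +
  fixes p :: nat
  assumes prime_p: "Factorial_Ring.prime p"
    and finite_carrier: "finite (carrier G)"
    and order_prime_power: "\<exists>n. order G = p ^ n"
begin

lemma p_ge_2: "p \<ge> 2" and p_pos: "p > 0"
  using prime_p by (simp_all add: prime_ge_2_nat prime_gt_0_nat)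

lemma finite_subgroup: "subgroup H G \<Longrightarrow> finite H"
  by (rule finite_subset[OF subgroup.subset finite_carrier])

lemma card_subgroup_pos: "subgroup H G \<Longrightarrow> card H > 0"
  using finite_subgroup[of H] subgroup.one_closed[of H G] by (auto simp: card_gt_0_iff)

lemma card_subgroup_power:
  assumes "subgroup H G"
  shows "\<exists>k. card H = p ^ k"
proof -
  obtain n where "order G = p ^ n" using order_prime_power by blast
  then have "card H dvd p ^ n"
    using lagrange[OF assms] by (metis dvd_triv_right)
  then show ?thesis
    using divides_primepow_nat[OF prime_p] by blast
qed

lemma card_proper_subgroup:
  assumes "subgroup A G" "subgroup B G" "B \<subset> A"
  shows "p * card B \<le> card A"
proof -
  obtain a b where ab: "card A = p ^ a" "card B = p ^ b"
    using card_subgroup_power[OF assms(1)] card_subgroup_power[OF assms(2)] by blast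
  have "card B < card A"
    using psubset_card_mono[OF finite_subgroup[OF assms(1)] assms(3)] .
  then have "b < a"
    using ab p_ge_2 by (intro power_less_imp_less_exp[of p b a]) auto
  then have "p ^ Suc b \<le> p ^ a"
    using p_pos by (intro power_increasing) auto
  then show ?thesis using ab by simp
qed

text \<open>The intersection of A and C is strictly larger than B, and index at most p leaves no
  room for a proper subgroup of A strictly above B.\<close>

lemma subgroup_of_index_le_p:
  assumes "subgroup A G" "subgroup B G" "subgroup C G"
    and "card A \<le> p * card B" "B \<subseteq> A" "B \<subseteq> C" "y \<in> A" "y \<in> C" "y \<notin> B"
  shows "A \<subseteq> C"
proof -
  have sub: "subgroup (A \<inter> C) G"
    by (rule subgroups_Inter_pair[OF assms(1,3)])
  have "B \<subset> A \<inter> C" using assms by blast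
  then have "p * card B \<le> card (A \<inter> C)"
    by (rule card_proper_subgroup[OF sub assms(2)])
  then have "A \<inter> C = A"
    using assms(4) by (intro card_seteq finite_subgroup assms) auto
  then show ?thesis by blast
qed

text \<open>Class equation inside N: the class of the identity has one element. If no other element
  of N were central, every other class would have size divisible by p, and so |N| would be 1 modulo
  p.\<close>

lemma normal_meets_center:
  assumes N: "N \<lhd> G" and nontriv: "N \<noteq> {\<one>}"
  shows "\<exists>z \<in> N. z \<noteq> \<one> \<and> (\<forall>g \<in> carrier G. commutator G z g = \<one>)"
proof (rule ccontr)
  assume no: "\<not> ?thesis"
  define \<phi> where "\<phi> = (\<lambda>g. \<lambda>h \<in> carrier G. g \<otimes> h \<otimes> inv g)"
  interpret act: group_action G "carrier G" \<phi>
    unfolding \<phi>_def by (rule action_by_conjugation)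
  have Ns: "subgroup N G" using N by (rule normal_imp_subgroup)
  have Nc: "x \<in> carrier G" if "x \<in> N" for x
    by (rule subgroup.mem_carrier[OF Ns that])
  have orb: "orbit G \<phi> x = {g \<otimes> x \<otimes> inv g | g. g \<in> carrier G}" if "x \<in> carrier G" for x
    using that by (simp add: orbit_def \<phi>_def)
  let ?O = "(\<lambda>x. orbit G \<phi> x) ` N"
  have self: "x \<in> orbit G \<phi> x" if "x \<in> carrier G" for x
    using that by (rule act.orbit_refl)
  have orbN: "orbit G \<phi> x \<subseteq> N" if "x \<in> N" for x
    unfolding orb[OF Nc[OF that]] using normal_conj(1)[OF N that] by auto
  have "\<Union> ?O = N"
  proof
    show "\<Union> ?O \<subseteq> N" using orbN by auto
    show "N \<subseteq> \<Union> ?O" using self Nc by auto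
  qed
  moreover have fin: "finite N" by (rule finite_subgroup[OF Ns])
  moreover have "o1 \<inter> o2 = {}" if "o1 \<in> ?O" "o2 \<in> ?O" "o1 \<noteq> o2" for o1 o2
    using that act.disjoint_union[of o1 o2] Nc unfolding orbits_def by auto
  ultimately have "card N = (\<Sum>o1 \<in> ?O. card o1)"
    using card_Union_disjoint[of ?O] finite_subset[OF Sup_upper[of _ ?O]]
    by (simp add: disjnt_def pairwise_def)
  also have "\<dots> = card (orbit G \<phi> \<one>) + (\<Sum>o1 \<in> ?O - {orbit G \<phi> \<one>}. card o1)"
    using fin subgroup.one_closed[OF Ns] by (intro sum.remove) auto
  also have "orbit G \<phi> \<one> = {\<one>}"
  proof
    show "orbit G \<phi> \<one> \<subseteq> {\<one>}" unfolding orb[OF one_closed] by auto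
    show "{\<one>} \<subseteq> orbit G \<phi> \<one>" using self[OF one_closed] by simp
  qed
  finally have card: "card N = 1 + (\<Sum>o1 \<in> ?O - {{\<one>}}. card o1)" by simp
  have "p dvd card o1" if o1: "o1 \<in> ?O - {{\<one>}}" for o1
  proof -
    obtain x where x: "x \<in> N" "o1 = orbit G \<phi> x" using o1 by blast
    have xc: "x \<in> carrier G" using x Nc by blast
    have "x \<noteq> \<one>" using o1 x \<open>orbit G \<phi> \<one> = {\<one>}\<close> by auto
    then obtain g where g: "g \<in> carrier G" "commutator G x g \<noteq> \<one>"
      using no x by blast
    have "inv g \<otimes> x \<otimes> inv (inv g) \<in> o1"
      unfolding x(2) orb[OF xc] using inv_closed[OF g(1)] by auto
    moreover have "inv g \<otimes> x \<otimes> inv (inv g) = x \<otimes> commutator G x g"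
      using g xc by (simp add: group_word_simps)
    moreover have "x \<otimes> commutator G x g \<noteq> x"
      using g xc by simp
    ultimately have "o1 \<noteq> {x}" by auto
    have "card o1 dvd order G"
      unfolding x(2) act.orbit_stabilizer_theorem[OF xc, symmetric] by simp
    then obtain k where k: "card o1 = p ^ k"
      using order_prime_power divides_primepow_nat[OF prime_p] by auto
    have "card o1 \<noteq> 1"
      using \<open>o1 \<noteq> {x}\<close> self[OF xc] x by (auto simp: card_1_singleton_iff)
    then show ?thesis using k by (cases k) auto
  qed
  then have "p dvd (\<Sum>o1 \<in> ?O - {{\<one>}}. card o1)"
    by (rule dvd_sum)
  moreover have "p dvd card N"
  proof -
    obtain k where k: "card N = p ^ k" using card_subgroup_power[OF Ns] by blast
    have "card N \<noteq> 1"
      using nontriv subgroup.one_closed[OF Ns] by (auto simp: card_1_singleton_iff)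
    then show ?thesis using k by (cases k) auto
  qed
  ultimately have "p dvd 1"
    using card dvd_add_left_iff[of p "\<Sum>o1 \<in> ?O - {{\<one>}}. card o1" 1] by simp
  then show False using p_ge_2 by simp
qed

lemma finite_p_group_FactGroup:
  assumes "A \<lhd> G"
  shows "finite_p_group (G Mod A) p"
proof -
  have A: "subgroup A G" using assms by (rule normal_imp_subgroup)
  interpret A: normal A G by (rule assms)
  have "card (rcosets A) * card A = order G"
    by (rule lagrange[OF A])
  then have "order G = order (G Mod A) * card A"
    by (simp add: order_def FactGroup_def)
  then have "order (G Mod A) dvd order G" by (rule dvdI)
  then have "\<exists>n. order (G Mod A) = p ^ n"
    using order_prime_power divides_primepow_nat[OF prime_p] by auto
  then show ?thesis
    using A.factorgroup_is_group prime_p finite_carrier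
    by (simp add: finite_p_group_def finite_p_group_axioms_def carrier_FactGroup)
qed

lemma rcos_eq_iff:
  assumes "subgroup A G" "x \<in> carrier G"
  shows "A #> x = A \<longleftrightarrow> x \<in> A"
  using coset_join1[OF _ assms(2,1)] coset_join2[OF assms(2,1)] by blast

lemma central_element_mod:
  assumes A: "A \<lhd> G" and B: "B \<lhd> G" and AB: "A \<subset> B"
  shows "\<exists>z \<in> B. z \<notin> A \<and> z \<in> centralizer_mod G (carrier G) A"
proof -
  interpret Q: finite_p_group "G Mod A" p
    by (rule finite_p_group_FactGroup[OF A])
  interpret \<phi>: group_hom G "G Mod A" "\<lambda>a. A #> a"
    by (rule group_hom_FactGroup[OF A])
  have As: "subgroup A G" and Bs: "subgroup B G"
    using A B by (simp_all add: normal_imp_subgroup)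
  have nB: "(\<lambda>a. A #> a) ` B \<lhd> G Mod A"
    using normal.surj_hom_normal_subgroup[OF B \<phi>.group_hom_axioms] by (simp add: carrier_FactGroup)
  obtain b where b: "b \<in> B" "b \<notin> A" using AB by blast
  then have "A #> b \<noteq> A"
    using rcos_eq_iff[OF As subgroup.mem_carrier[OF Bs b(1)]] by simp
  then have "(\<lambda>a. A #> a) ` B \<noteq> {\<one>\<^bsub>G Mod A\<^esub>}"
    using b by auto
  from Q.normal_meets_center[OF nB this] obtain z where z: "z \<in> B" "A #> z \<noteq> A"
    and comm: "\<And>g. g \<in> carrier (G Mod A) \<Longrightarrow> commutator (G Mod A) (A #> z) g = A"
    by auto
  have zc: "z \<in> carrier G" by (rule subgroup.mem_carrier[OF Bs z(1)])
  have "commutator G z g \<in> A" if g: "g \<in> carrier G" for g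
    using comm[of "A #> g"] \<phi>.hom_commutator[OF zc g] g rcos_eq_iff[OF As] zc by simp
  moreover have "z \<notin> A"
    using z(2) rcos_eq_iff[OF As zc] by blast
  ultimately show ?thesis
    using z zc by (auto simp: centralizer_mod_def)
qed

text \<open>Replacing A by the part C of B that is central modulo A gains a factor of at least p. By
  induction n commutators reach C, and one more leads from C into A.\<close>

lemma iterated_commutator_subset_of_card:
  assumes "A \<lhd> G" "B \<lhd> G" "A \<subseteq> B" "card B \<le> p ^ n * card A"
  shows "iterated_commutator G B n \<subseteq> A"
  using assms
proof (induction n arbitrary: A)
  case 0
  then have "A = B"
    by (intro card_seteq finite_subgroup normal_imp_subgroup) auto
  then show ?case by simp
next
  case (Suc n)
  show ?case
  proof (cases "A = B")
    case True
    then show ?thesis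
      using iterated_commutator_antimono[OF Suc.prems(2), of 0 "Suc n"] by simp
  next
    case False
    then have AB: "A \<subset> B" using Suc.prems by blast
    define C where "C = B \<inter> centralizer_mod G (carrier G) A"
    have C: "C \<lhd> G"
      unfolding C_def by (intro normal_subgroup_intersect normal_centralizer_mod Suc.prems)
    obtain z where "z \<in> B" "z \<notin> A" "z \<in> centralizer_mod G (carrier G) A"
      using central_element_mod[OF Suc.prems(1,2) AB] by blast
    then have "A \<subset> C"
      unfolding C_def using AB centralizer_mod_incl[OF Suc.prems(1)] by blast
    then have "p * card A \<le> card C"
      by (intro card_proper_subgroup normal_imp_subgroup C Suc.prems)
    then have "p ^ n * (p * card A) \<le> p ^ n * card C"
      by (rule mult_le_mono2)
    moreover have "p ^ Suc n * card A = p ^ n * (p * card A)"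
      by simp
    ultimately have "card B \<le> p ^ n * card C"
      using Suc.prems(4) by linarith
    then have "iterated_commutator G B n \<subseteq> C"
      using Suc.IH[OF C Suc.prems(2)] by (simp add: C_def)
    then have "iterated_commutator G B n \<subseteq> centralizer_mod G (carrier G) A"
      by (simp add: C_def)
    then show ?thesis
      using commutator_subgroup_subset_iff[OF _ Suc.prems(1)]
        subgroup.subset[OF normal_imp_subgroup[OF normal_iterated_commutator[OF Suc.prems(2)]]]
      by simp
  qed
qed

corollary commutator_subset_of_card:
  assumes "A \<lhd> G" "B \<lhd> G" "A \<subseteq> B" "card B \<le> p * card A"
  shows "B \<subseteq> centralizer_mod G (carrier G) A"
  using iterated_commutator_subset_of_card[of A B 1] assms
    commutator_subgroup_subset_iff[OF subgroup.subset[OF normal_imp_subgroup[OF assms(2)]] assms(1)]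
  by simp

section \<open>Cyclic extensions and chief factors\<close>

lemma cyclic_extension:
  assumes A: "A \<lhd> G" and w: "w \<in> carrier G"
  shows "A <#> generate G {w} = {a \<otimes> w [^] i | a (i :: nat). a \<in> A}"
    and "subgroup (A <#> generate G {w}) G"
    and "A \<subseteq> A <#> generate G {w}" and "w \<in> A <#> generate G {w}"
proof -
  have gen: "subgroup (generate G {w}) G" and As: "subgroup A G"
    using w A by (auto intro: generate_is_subgroup normal_imp_subgroup)
  show "A <#> generate G {w} = {a \<otimes> w [^] i | a (i :: nat). a \<in> A}"
    unfolding generate_pow_on_finite_carrier[OF finite_carrier w] set_mult_def by auto
  show "subgroup (A <#> generate G {w}) G"
    by (rule mult_norm_subgroup[OF A gen])
  show "A \<subseteq> A <#> generate G {w}"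
    by (rule set_mult_upper(1)[OF As gen])
  show "w \<in> A <#> generate G {w}"
    using set_mult_upper(2)[OF As gen] generate.incl[of w "{w}" G] by blast
qed

lemma card_cyclic_extension:
  assumes A: "A \<lhd> G" and w: "w \<in> carrier G" and wp: "w [^] p \<in> A"
  shows "card (A <#> generate G {w}) \<le> p * card A"
proof -
  have As: "subgroup A G" using A by (rule normal_imp_subgroup)
  have "A <#> generate G {w} \<subseteq> (\<lambda>(a, i). a \<otimes> w [^] i) ` (A \<times> {..<p})"
  proof
    fix x assume "x \<in> A <#> generate G {w}"
    then obtain a and i :: nat where x: "x = a \<otimes> w [^] i" "a \<in> A"
      unfolding cyclic_extension(1)[OF A w] by blast
    have "w [^] i = w [^] (p * (i div p) + i mod p)" by simp
    also have "\<dots> = (w [^] p) [^] (i div p) \<otimes> w [^] (i mod p)"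
      using w by (simp only: nat_pow_mult[symmetric] nat_pow_pow[symmetric] nat_pow_closed)
    finally have "x = (a \<otimes> (w [^] p) [^] (i div p)) \<otimes> w [^] (i mod p)"
      using x w subgroup.mem_carrier[OF As x(2)] by (simp add: m_assoc)
    moreover have "a \<otimes> (w [^] p) [^] (i div p) \<in> A"
      by (intro subgroup.m_closed[OF As] subgroup_nat_pow_closed[OF As] x(2) wp)
    moreover have "i mod p < p" using p_pos by simp
    ultimately show "x \<in> (\<lambda>(a, i). a \<otimes> w [^] i) ` (A \<times> {..<p})"
      by (intro image_eqI[of _ _ "(a \<otimes> (w [^] p) [^] (i div p), i mod p)"]) auto
  qed
  then have "card (A <#> generate G {w}) \<le> card (A \<times> {..<p})"
    using finite_subgroup[OF As] by (intro surj_card_le) auto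
  then show ?thesis by (simp add: card_cartesian_product mult.commute)
qed

lemma normal_between_centralizer_mod:
  assumes A: "A \<lhd> G" and D: "subgroup D G" and AD: "A \<subseteq> D"
    and DC: "D \<subseteq> centralizer_mod G (carrier G) A"
  shows "D \<lhd> G"
proof (rule normal_invI[OF D])
  fix g d assume g: "g \<in> carrier G" and d: "d \<in> D"
  have "commutator G d (inv g) \<in> D"
    using d g DC AD by (auto simp: centralizer_mod_def)
  then have "d \<otimes> commutator G d (inv g) \<in> D"
    using d subgroup.m_closed[OF D] by blast
  moreover have "d \<in> carrier G" by (rule subgroup.mem_carrier[OF D d])
  ultimately show "g \<otimes> d \<otimes> inv g \<in> D"
    using g by (simp add: group_word_simps)
qed

text \<open>Some z in B outside A is central modulo A. A suitable power w of z is still outside A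
  but has its p-th power in A. Then A together with w generates a subgroup that is normal, being
  central modulo A, so it is B and has index p over A.\<close>

lemma card_chief_factor:
  assumes A: "A \<lhd> G" and B: "B \<lhd> G" and AB: "A \<subset> B"
    and no: "\<And>C. C \<lhd> G \<Longrightarrow> A \<subset> C \<Longrightarrow> C \<subseteq> B \<Longrightarrow> C = B"
  shows "card B = p * card A"
proof -
  have As: "subgroup A G" and Bs: "subgroup B G"
    using A B by (simp_all add: normal_imp_subgroup)
  let ?Z = "centralizer_mod G (carrier G) A"
  have Z: "subgroup ?Z G" using subgroup_centralizer_mod[OF A] by simp
  obtain z where z: "z \<in> B" "z \<notin> A" "z \<in> ?Z"
    using central_element_mod[OF A B AB] by blast
  have zc: "z \<in> carrier G" by (rule subgroup.mem_carrier[OF Bs z(1)])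
  obtain n where "order G = p ^ n" using order_prime_power by blast
  then have ex: "z [^] (p ^ n) \<in> A"
    using pow_order_eq_1[OF zc] subgroup.one_closed[OF As] by simp
  define j where "j = (LEAST j. z [^] (p ^ j) \<in> A)"
  have j: "z [^] (p ^ j) \<in> A" unfolding j_def by (rule LeastI[of _ n]) (rule ex)
  have "j \<noteq> 0" using j z zc by (metis nat_pow_eone power_0)
  then obtain i where i: "j = Suc i" using not0_implies_Suc by blast
  define w where "w = z [^] (p ^ i)"
  have "w \<notin> A" unfolding w_def using not_less_Least[of i "\<lambda>j. z [^] (p ^ j) \<in> A"] i j_def by simp
  have wp: "w [^] p \<in> A"
    using j zc by (simp add: w_def i nat_pow_pow mult.commute)
  have wB: "w \<in> B" and wZ: "w \<in> ?Z" and wc: "w \<in> carrier G"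
    unfolding w_def by (intro subgroup_nat_pow_closed Bs Z z nat_pow_closed zc)+
  let ?D = "A <#> generate G {w}"
  have D: "subgroup ?D G" "A \<subseteq> ?D" "w \<in> ?D"
    using cyclic_extension[OF A wc] by auto
  have DB: "?D \<subseteq> B" and DZ: "?D \<subseteq> ?Z"
    using wB wZ AB centralizer_mod_incl[OF A] Bs Z
    by (intro set_mult_least generate_subgroup_incl; auto)+
  have "?D \<lhd> G" by (rule normal_between_centralizer_mod[OF A D(1,2) DZ])
  then have "?D = B" using no D DB \<open>w \<notin> A\<close> by blast
  then have "card B \<le> p * card A"
    using card_cyclic_extension[OF A wc wp] by simp
  then show ?thesis
    using card_proper_subgroup[OF Bs As AB] by simp
qed

lemma chief_factor_above:
  assumes A: "A \<lhd> G" and B: "B \<lhd> G" and AB: "A \<subset> B"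
  shows "\<exists>C. C \<lhd> G \<and> A \<subset> C \<and> C \<subseteq> B \<and> card C = p * card A"
proof -
  obtain C where C: "C \<lhd> G \<and> A \<subset> C \<and> C \<subseteq> B"
    and min: "\<And>D. D \<lhd> G \<and> A \<subset> D \<and> D \<subseteq> B \<Longrightarrow> card C \<le> card D"
    using ex_has_least_nat[of "\<lambda>C. C \<lhd> G \<and> A \<subset> C \<and> C \<subseteq> B" B card] B AB by blast
  have "card C = p * card A"
  proof (rule card_chief_factor[OF A])
    fix D assume "D \<lhd> G" "A \<subset> D" "D \<subseteq> C"
    then show "D = C"
      using min[of D] C by (intro card_seteq finite_subgroup normal_imp_subgroup) auto
  qed (use C in auto)
  then show ?thesis using C by blast
qed

lemma chief_factor_below:
  assumes A: "A \<lhd> G" and B: "B \<lhd> G" and AB: "A \<subset> B"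
  shows "\<exists>C. C \<lhd> G \<and> A \<subseteq> C \<and> C \<subset> B \<and> card B = p * card C"
proof -
  have fB: "finite B" by (intro finite_subgroup normal_imp_subgroup B)
  have bound: "card C < Suc (card B)" if "C \<lhd> G \<and> A \<subseteq> C \<and> C \<subset> B" for C
    using card_mono[OF fB, of C] that by (simp add: psubset_imp_subset less_Suc_eq_le)
  obtain C where C: "C \<lhd> G \<and> A \<subseteq> C \<and> C \<subset> B"
    and max: "\<And>D. D \<lhd> G \<and> A \<subseteq> D \<and> D \<subset> B \<Longrightarrow> card D \<le> card C"
    using ex_has_greatest_nat[of "\<lambda>C. C \<lhd> G \<and> A \<subseteq> C \<and> C \<subset> B" A card "Suc (card B)"]
      A AB bound by blast
  have "card B = p * card C"
  proof (rule card_chief_factor[OF _ B])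
    fix D assume D: "D \<lhd> G" "C \<subset> D" "D \<subseteq> B"
    show "D = B"
    proof (rule ccontr)
      assume "D \<noteq> B"
      then have "card D \<le> card C" using max[of D] D C by blast
      moreover have "card C < card D"
        using D finite_subset[OF _ fB] by (intro psubset_card_mono) auto
      ultimately show False by simp
    qed
  qed (use C in auto)
  then show ?thesis using C by blast
qed

lemma pow_p_mem_of_index_p:
  assumes L: "L \<lhd> G" and M: "subgroup M G" and LM: "L \<subseteq> M" and card: "card M = p * card L"
    and m: "m \<in> M"
  shows "m [^] p \<in> L"
proof -
  let ?M = "G\<lparr>carrier := M\<rparr>"
  have Ls: "subgroup L G" using L by (rule normal_imp_subgroup)
  have nL: "L \<lhd> ?M"
    using L M LM by (intro normal_restrict_supergroup)
  interpret M: group ?M by (rule subgroup_imp_group[OF M])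
  interpret nL: normal L ?M by (rule nL)
  interpret Q: group "?M Mod L" by (rule nL.factorgroup_is_group)
  have "card (rcosets\<^bsub>?M\<^esub> L) * card L = p * card L"
    using M.lagrange[OF nL.is_subgroup] card by (simp add: order_def)
  then have ord: "order (?M Mod L) = p"
    using card_subgroup_pos[OF Ls] by (simp add: order_def FactGroup_def)
  have "(L #>\<^bsub>?M\<^esub> m) [^]\<^bsub>?M Mod L\<^esub> p = L"
    using Q.pow_order_eq_1[of "L #>\<^bsub>?M\<^esub> m"] m ord by (simp add: carrier_FactGroup)
  then have "L #>\<^bsub>?M\<^esub> (m [^]\<^bsub>?M\<^esub> p) = L"
    using nL.FactGroup_pow[of m p] m by simp
  then have "m [^]\<^bsub>?M\<^esub> p \<in> L"
    using M.coset_join1[of L "m [^]\<^bsub>?M\<^esub> p"] nL.is_subgroup nL.subset M.nat_pow_closed m by auto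
  moreover have "m [^]\<^bsub>?M\<^esub> p = m [^] p"
    by (rule nat_pow_consistent[symmetric])
  ultimately show ?thesis by simp
qed

lemma cyclic_extension_of_index_p:
  assumes L: "L \<lhd> G" and M: "subgroup M G" and LM: "L \<subseteq> M" and card: "card M = p * card L"
    and c: "c \<in> M" "c \<notin> L"
  shows "M = L <#> generate G {c}"
proof
  have cc: "c \<in> carrier G" by (rule subgroup.mem_carrier[OF M c(1)])
  have Ls: "subgroup L G" using L by (rule normal_imp_subgroup)
  show "M \<subseteq> L <#> generate G {c}"
    using subgroup_of_index_le_p[OF M Ls cyclic_extension(2)[OF L cc] _ LM
        cyclic_extension(3)[OF L cc] c(1) cyclic_extension(4)[OF L cc] c(2)] card by simp
  show "L <#> generate G {c} \<subseteq> M"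
    using c LM by (intro set_mult_least M generate_subgroup_incl) auto
qed

end

section \<open>Powers in the derived subgroup\<close>

context finite_p_group
begin

text \<open>The case \<open>e = 0\<close> is for \<open>k \<in> G\<close>, the case \<open>e = 1\<close> for \<open>k \<in> G'\<close>, which gains one commutator
  in the error term.\<close>

lemma p_power_mult_mod:
  assumes N: "N \<lhd> G" and Ne: "N \<subseteq> iterated_commutator G (carrier G) e"
    and k: "k \<in> iterated_commutator G (carrier G) e"
    and K: "subgroup K G" and Kp: "iterated_commutator G N (p - 1 + e) \<subseteq> K"
    and K2: "\<And>h. h \<in> iterated_commutator G N (Suc e) \<Longrightarrow> h [^] p \<in> K"
    and a: "a \<in> N <#> generate G {k}" and b: "b \<in> N <#> generate G {k}"
  shows "inv (b [^] p) \<otimes> inv (a [^] p) \<otimes> (a \<otimes> b) [^] p \<in> K"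
proof -
  let ?S = "N <#> generate G {k}"
  let ?I = "iterated_commutator G N" and ?L = "iterated_commutator G (carrier G)"
  have nI: "?I i \<lhd> G" and nL: "?L i \<lhd> G" for i
    using normal_iterated_commutator N normal_self by auto
  have sI: "subgroup (?I i) G" and sL: "subgroup (?L i) G" for i
    using nI nL by (auto intro: normal_imp_subgroup)
  have kc: "k \<in> carrier G" by (rule subgroup.mem_carrier[OF sL k])
  have S: "subgroup ?S G" "N \<subseteq> ?S" "k \<in> ?S"
    using cyclic_extension[OF N kc] by auto
  have Sc: "?S \<subseteq> carrier G" by (rule subgroup.subset[OF S(1)])
  have SL: "?S \<subseteq> ?L e"
    using k by (intro set_mult_least sL Ne generate_subgroup_incl) auto
  have least: "?S \<subseteq> C" if "subgroup C G" "N \<subseteq> C" "k \<in> C" for C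
    using that by (intro set_mult_least generate_subgroup_incl) auto
  have NI: "commutator G n s \<in> ?I (Suc e)" if "n \<in> N" "s \<in> ?S" for n s
    using commutator_lower_central[OF N, of n 0 s e] that SL by auto
  have Nc: "N \<subseteq> carrier G" by (rule subgroup.subset[OF normal_imp_subgroup[OF N]])
  \<comment> \<open>S is generated by N and the single element k, so commutators within S are
    located in two rounds: against k, where [k, k] = 1, and then against all of S.\<close>
  have "?S \<subseteq> centralizer_mod G {k} (?I (Suc e))"
  proof (rule least)
    show "subgroup (centralizer_mod G {k} (?I (Suc e))) G"
      using kc by (intro subgroup_centralizer_mod nI) simp
    show "N \<subseteq> centralizer_mod G {k} (?I (Suc e))"
      using NI S(3) Nc by (auto simp: centralizer_mod_def)
    show "k \<in> centralizer_mod G {k} (?I (Suc e))"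
      using kc subgroup.one_closed[OF sI[of "Suc e"]]
      by (simp add: centralizer_mod_def group_word_simps)
  qed
  then have kS: "commutator G k s \<in> ?I (Suc e)" if "s \<in> ?S" for s
    using that kc Sc by (intro commutator_swap_mem[OF sI, of s k]) (auto simp: centralizer_mod_def)
  have SS: "?S \<subseteq> centralizer_mod G ?S (?I (Suc e))"
  proof (rule least)
    show "subgroup (centralizer_mod G ?S (?I (Suc e))) G"
      by (intro subgroup_centralizer_mod nI Sc)
    show "N \<subseteq> centralizer_mod G ?S (?I (Suc e))"
      using NI Nc by (auto simp: centralizer_mod_def)
    show "k \<in> centralizer_mod G ?S (?I (Suc e))"
      using kS kc by (auto simp: centralizer_mod_def)
  qed
  \<comment> \<open>From \<open>H 2\<close> on, which has \<open>Suc e\<close> copies of G, each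
    level adds one commutator. Hence \<open>H p\<close> has p - 1 + e copies.\<close>
  define H where "H i = (if i \<le> 1 then ?S else ?I (i - 1 + e))" for i
  have I_antimono: "?I j \<subseteq> ?I i" if "i \<le> j" for i j
    using iterated_commutator_antimono[OF N that] .
  have IS: "?I i \<subseteq> ?S" for i
    using I_antimono[of 0 i] S(2) by auto
  have I_mem: "x \<in> H m" if "x \<in> ?I j" "m \<le> Suc j - e" "e \<le> j" for x j m
  proof (cases "m \<le> 1")
    case True
    then show ?thesis using that IS by (auto simp: H_def)
  next
    case False
    then have "m - 1 + e \<le> j" using that by simp
    then show ?thesis using I_antimono that(1) False by (auto simp: H_def)
  qed
  have "filtration G H"
    unfolding filtration_def
  proof (intro conjI allI ballI)
    show "subgroup (H i) G" for i
      using S(1) sI by (simp add: H_def)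
    show "H (Suc i) \<subseteq> H i" for i
      using IS I_antimono[of "i - 1 + e" "i + e"] by (auto simp: H_def)
    fix i j x y assume x: "x \<in> H i" and y: "y \<in> H j"
    have c: "x \<in> carrier G" "y \<in> carrier G"
      using x y Sc sI subgroup.mem_carrier unfolding H_def by (metis subsetD)+
    consider "i \<le> 1" "j \<le> 1" | "i \<le> 1" "j > 1" | "i > 1" "j \<le> 1" | "i > 1" "j > 1"
      by linarith
    then show "commutator G x y \<in> H (i + j)"
    proof cases
      case 1
      then have "commutator G x y \<in> ?I (Suc e)"
        using x y SS by (auto simp: H_def centralizer_mod_def)
      then show ?thesis by (rule I_mem) (use 1 in auto)
    next
      case 2
      then have "commutator G y x \<in> ?I (Suc (j - 1 + e))"
        using y c by (intro iterated_commutator_memI) (auto simp: H_def)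
      then have "commutator G x y \<in> ?I (Suc (j - 1 + e))"
        by (rule commutator_swap_mem[OF sI c(2,1)])
      then show ?thesis by (rule I_mem) (use 2 in auto)
    next
      case 3
      then have "commutator G x y \<in> ?I (Suc (i - 1 + e))"
        using x c by (intro iterated_commutator_memI) (auto simp: H_def)
      then show ?thesis by (rule I_mem) (use 3 in auto)
    next
      case 4
      have "y \<in> ?L (j - 1 + e)"
        using y 4 iterated_commutator_mono[OF N normal_self Nc] by (auto simp: H_def)
      then have "commutator G x y \<in> ?I (i - 1 + e + (j - 1 + e) + 1)"
        using x 4 by (intro commutator_lower_central[OF N]) (auto simp: H_def)
      then show ?thesis by (rule I_mem) (use 4 in auto)
    qed
  qed
  then show ?thesis
    using p_ge_2 Kp K2 a b
    by (intro Hall_Petrescu_mod[of H, OF _ _ prime_p K]) (auto simp: H_def)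
qed

text \<open>If the conclusion fails, there is \<open>A \<supseteq> L\<^sup>p\<close> with \<open>|M\<^sup>p : A| = p\<^sup>2\<close>. Then \<open>|L : A| \<le> p\<^sup>p\<close>, so the
  \<open>p\<close>-power map is multiplicative modulo \<open>A\<close>, and \<open>M\<^sup>p\<close> is generated modulo \<open>A\<close> by the power of
  one element.\<close>

lemma card_power_subgroup_of_index_p:
  assumes M: "M \<lhd> G" and MD: "M \<subseteq> iterated_commutator G (carrier G) 1"
    and L: "L \<lhd> G" and LM: "L \<subseteq> M" and idx: "card M = p * card L"
    and bound: "card M \<le> p ^ (p - 1) * card (power_subgroup G M p)"
  shows "card (power_subgroup G M p) \<le> p * card (power_subgroup G L p)"
proof (rule ccontr)
  let ?P = "\<lambda>A. power_subgroup G A p"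
  assume "\<not> ?thesis"
  then have gt: "p * card (?P L) < card (?P M)" by simp
  have nP: "?P M \<lhd> G" "?P L \<lhd> G" using M L by (auto intro: normal_power_subgroup)
  have Ms: "subgroup M G" and Ls: "subgroup L G" using M L by (auto intro: normal_imp_subgroup)
  have PL: "?P L \<subseteq> ?P M" by (rule power_subgroup_mono[OF M LM])
  have "?P L \<noteq> ?P M" using gt p_ge_2 by auto
  then obtain A1 where A1: "A1 \<lhd> G" "?P L \<subseteq> A1" "A1 \<subset> ?P M" "card (?P M) = p * card A1"
    using chief_factor_below[OF nP(2,1)] PL by blast
  have "?P L \<noteq> A1" using gt A1(4) by auto
  then obtain A where A: "A \<lhd> G" "?P L \<subseteq> A" "A \<subset> A1" "card A1 = p * card A"
    using chief_factor_below[OF nP(2) A1(1)] A1(2) by blast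
  have As: "subgroup A G" by (rule normal_imp_subgroup[OF A(1)])
  have MpL: "m [^] p \<in> L" if "m \<in> M" for m
    by (rule pow_p_mem_of_index_p[OF L Ms LM idx that])
  then have PML: "?P M \<subseteq> L" by (rule power_subgroup_leI[OF Ls])
  \<comment> \<open>|M^p : A| = p^2 and |M : L| = p turn the bound on |M : M^p| into |L : A| \<le>
    p^p. This needs p commutators to reach A, one more than p - 1; since M lies in G', the case e =
    1 of \<open>p_power_mult_mod\<close> provides it.\<close>
  have "p * card L \<le> p ^ (p - 1) * (p * (p * card A))"
    using bound idx A1(4) A(4) by simp
  then have "p * card L \<le> p * (p ^ (p - 1) * p * card A)"
    by (simp add: mult_ac)
  moreover have "p ^ (p - 1) * p = p ^ p"
    using p_pos by (simp flip: power_Suc2)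
  ultimately have "card L \<le> p ^ p * card A"
    using p_pos by simp
  then have LA: "iterated_commutator G L p \<subseteq> A"
    using A A1 PML by (intro iterated_commutator_subset_of_card L) auto
  have "L \<noteq> M" using idx card_subgroup_pos[OF Ls] p_ge_2 by auto
  then obtain c where c: "c \<in> M" "c \<notin> L" using LM by blast
  have M_eq: "M = L <#> generate G {c}"
    by (rule cyclic_extension_of_index_p[OF L Ms LM idx c])
  have cc: "c \<in> carrier G" by (rule subgroup.mem_carrier[OF Ms c(1)])
  have mod: "inv (b [^] p) \<otimes> inv (a [^] p) \<otimes> (a \<otimes> b) [^] p \<in> A" if "a \<in> M" "b \<in> M" for a b
  proof (rule p_power_mult_mod[OF L _ _ As])
    show "L \<subseteq> iterated_commutator G (carrier G) 1" using LM MD by blast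
    show "c \<in> iterated_commutator G (carrier G) 1" using c MD by blast
    show "iterated_commutator G L (p - 1 + 1) \<subseteq> A" using LA p_pos by simp
    show "h [^] p \<in> A" if "h \<in> iterated_commutator G L (Suc 1)" for h
    proof -
      have "h \<in> L" using that iterated_commutator_antimono[OF L, of 0 "Suc 1"] by auto
      then show ?thesis using power_subgroup_memI[of h L p] A(2) by blast
    qed
  qed (use that M_eq in auto)
  define w where "w = c [^] p"
  have wc: "w \<in> carrier G" unfolding w_def using cc by simp
  let ?D = "A <#> generate G {w}"
  have "m [^] p \<in> ?D" if m: "m \<in> M" for m
  proof -
    obtain l and i :: nat where li: "m = l \<otimes> c [^] i" "l \<in> L"
      using m unfolding M_eq cyclic_extension(1)[OF L cc] by blast
    have lc: "l \<in> carrier G" by (rule subgroup.mem_carrier[OF Ls li(2)])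
    have lM: "l \<in> M" using li LM by blast
    have ciM: "c [^] i \<in> M" by (rule subgroup_nat_pow_closed[OF Ms c(1)])
    define x where "x = inv ((c [^] i) [^] p) \<otimes> inv (l [^] p) \<otimes> m [^] p"
    have "x \<in> A" unfolding x_def li(1) by (rule mod[OF lM ciM])
    moreover have lA: "l [^] p \<in> A" using power_subgroup_memI[of l L p] li A(2) by blast
    moreover have wi: "(c [^] i) [^] p = w [^] i"
      unfolding w_def using cc by (simp add: nat_pow_pow mult.commute)
    have mc: "m \<in> carrier G" by (rule subgroup.mem_carrier[OF Ms m])
    have wiD: "w [^] i \<in> ?D"
      using subgroup_nat_pow_closed[OF cyclic_extension(2,4)[OF A(1) wc]] .
    have "m [^] p = l [^] p \<otimes> w [^] i \<otimes> x"
      using lc wc mc by (simp add: x_def wi group_word_simps)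
    moreover have AD: "A \<subseteq> ?D" by (rule cyclic_extension(3)[OF A(1) wc])
    ultimately show ?thesis
      using wiD subgroup.m_closed[OF cyclic_extension(2)[OF A(1) wc]] by (simp add: subset_iff)
  qed
  then have "?P M \<subseteq> ?D"
    by (rule power_subgroup_leI[OF cyclic_extension(2)[OF A(1) wc]])
  then have "card (?P M) \<le> card ?D"
    by (intro card_mono finite_subgroup cyclic_extension(2)[OF A(1) wc])
  \<comment> \<open>c^p lies in L, so w^p = (c^p)^p lies in L^p and therefore in A. This gives |M^p
    : A| \<le> p, against p^2.\<close>
  also have "w [^] p \<in> A"
    using power_subgroup_memI[OF MpL[OF c(1)], of p] A(2) unfolding w_def by blast
  then have "card ?D \<le> p * card A" by (rule card_cyclic_extension[OF A(1) wc])
  finally have "p * (p * card A) \<le> p * card A" using A1(4) A(4) by simp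
  then show False using p_ge_2 card_subgroup_pos[OF As] by simp
qed

text \<open>Descending from N in steps of index p, |M| drops by the factor p and |M^p| by at most
  that factor, so the quotient |M| / |M^p| never grows.\<close>

lemma card_power_subgroup_bound:
  assumes N: "N \<lhd> G" and ND: "N \<subseteq> iterated_commutator G (carrier G) 1"
    and bound: "card N \<le> p ^ (p - 1) * card (power_subgroup G N p)"
    and M: "M \<lhd> G" "M \<subseteq> N"
  shows "card M \<le> p ^ (p - 1) * card (power_subgroup G M p)"
  using M
proof (induction "card N - card M" arbitrary: M rule: less_induct)
  case less
  show ?case
  proof (cases "M = N")
    case False
    then obtain C where C: "C \<lhd> G" "M \<subset> C" "C \<subseteq> N" "card C = p * card M"
      using chief_factor_above[OF less.prems(1) N] less.prems(2) by blast
    have fin: "finite N" "finite C"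
      using N C(1) finite_subgroup normal_imp_subgroup by auto
    have "card N - card C < card N - card M"
      using psubset_card_mono[OF fin(2) C(2)] card_mono[OF fin(1) C(3)] by linarith
    from less.hyps[OF this C(1)] have IH: "card C \<le> p ^ (p - 1) * card (power_subgroup G C p)"
      using C(3) by simp
    have "card (power_subgroup G C p) \<le> p * card (power_subgroup G M p)"
      using C ND less.prems IH by (intro card_power_subgroup_of_index_p) auto
    from mult_le_mono2[OF this, of "p ^ (p - 1)"]
    have "p ^ (p - 1) * card (power_subgroup G C p) \<le>
        p ^ (p - 1) * (p * card (power_subgroup G M p))" .
    also have "\<dots> = p * (p ^ (p - 1) * card (power_subgroup G M p))"
      by (rule mult.left_commute)
    finally have "p * card M \<le> p * (p ^ (p - 1) * card (power_subgroup G M p))"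
      using IH C(4) by linarith
    then show ?thesis using p_pos by simp
  qed (use bound in simp)
qed

text \<open>It suffices to place the commutator of L with p - 2 copies of G in a subgroup that is
  central modulo L1^p. If [M, G] \<le> L1, this subgroup is M^p, because [n^p, g] is congruent to
  [n, g]^p, which lies in L1^p. Otherwise [M, G] and L1 generate L, and the subgroup is L^p:
  \<open>hyp\<close> takes care of [M, G], the index bound of L1.\<close>

lemma iterated_commutator_power_subgroup_step:
  assumes M: "M \<lhd> G" and MD: "M \<subseteq> iterated_commutator G (carrier G) 1"
    and L: "L \<lhd> G" "L \<subseteq> M" "card M = p * card L"
    and L1: "L1 \<lhd> G" "L1 \<subseteq> L" "card L = p * card L1"
    and boundM: "card M \<le> p ^ (p - 1) * card (power_subgroup G M p)"
    and hyp: "iterated_commutator G M (p - 1) \<subseteq> power_subgroup G L p"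
  shows "iterated_commutator G L (p - 1) \<subseteq> power_subgroup G L1 p"
proof -
  let ?P = "\<lambda>A. power_subgroup G A p" and ?I = "iterated_commutator G"
  note bound = card_power_subgroup_bound[OF M MD boundM]
  have Ms: "subgroup M G" and Ls: "subgroup L G" and L1s: "subgroup L1 G"
    using M L(1) L1(1) by (auto intro: normal_imp_subgroup)
  have nP: "?P M \<lhd> G" "?P L \<lhd> G" "?P L1 \<lhd> G"
    using M L(1) L1(1) by (auto intro: normal_power_subgroup)
  have "?P L \<subseteq> L1"
    by (intro power_subgroup_leI[OF L1s] pow_p_mem_of_index_p[OF L1(1) Ls L1(2,3)])
  have "card (?P L) \<le> p * card (?P L1)"
    using MD L(2) by (intro card_power_subgroup_of_index_p L(1) L1 bound[OF L(1,2)]) blast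
  then have PL: "?P L \<subseteq> centralizer_mod G (carrier G) (?P L1)"
    by (intro commutator_subset_of_card nP power_subgroup_mono L1(2) L(1))
  have p1: "p - 1 = Suc (p - 2)" using p_ge_2 by simp
  have finish: "?I L (p - 1) \<subseteq> ?P L1"
    if "?I L (p - 2) \<subseteq> centralizer_mod G (carrier G) (?P L1)"
  proof -
    have "?I L (p - 2) \<subseteq> carrier G"
      using subgroup.subset[OF normal_imp_subgroup[OF normal_iterated_commutator[OF L(1)]]] .
    then show ?thesis
      unfolding p1 using that commutator_subgroup_subset_iff[OF _ nP(3)] by simp
  qed
  have cancel: "card B \<le> p ^ (p - 2) * c" if "p * card B \<le> p ^ (p - 1) * c" for B :: "'a set" and c
  proof -
    have "p ^ (p - 1) = p * p ^ (p - 2)" unfolding p1 by (rule power_Suc)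
    then show ?thesis using that p_pos by (simp only: mult.assoc nat_mult_le_cancel1)
  qed
  have L1c: "card L1 \<le> p ^ (p - 2) * card (?P L)"
    using bound[OF L(1,2)] L1(3) by (intro cancel) simp
  show ?thesis
  proof (cases "M \<subseteq> centralizer_mod G (carrier G) L1")
    case True
    have "?P M \<subseteq> centralizer_mod G (carrier G) (?P L1)"
    proof (rule power_subgroup_leI)
      show "subgroup (centralizer_mod G (carrier G) (?P L1)) G"
        using nP(3) by (intro subgroup_centralizer_mod) auto
      fix n assume n: "n \<in> M"
      have nc: "n \<in> carrier G" by (rule subgroup.mem_carrier[OF Ms n])
      have "commutator G (n [^] p) g \<in> ?P L1" if g: "g \<in> carrier G" for g
      proof -
        define u where "u = commutator G n g"
        have u: "u \<in> L1" using True n g by (auto simp: u_def centralizer_mod_def)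
        have uc: "u \<in> carrier G" by (rule subgroup.mem_carrier[OF L1s u])
        have "?I L1 (p - 1) \<subseteq> ?P L1"
          using L L1 by (intro iterated_commutator_subset_of_card nP bound power_subgroup_incl L1s) auto
        then have "?I L1 (p - 1 + 1) \<subseteq> ?P L1"
          using iterated_commutator_antimono[OF L1(1), of "p - 1" "p - 1 + 1"] by auto
        then have "inv (u [^] p) \<otimes> inv (n [^] p) \<otimes> (n \<otimes> u) [^] p \<in> ?P L1"
        proof (intro p_power_mult_mod[OF L1(1), where k = n and e = 1] normal_imp_subgroup[OF nP(3)])
          show "L1 \<subseteq> ?I (carrier G) 1" "n \<in> ?I (carrier G) 1" using L1 L MD n by blast+
          show "h [^] p \<in> ?P L1" if "h \<in> ?I L1 (Suc 1)" for h
          proof -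
            have "h \<in> L1" using that iterated_commutator_antimono[OF L1(1), of 0 "Suc 1"] by auto
            then show ?thesis by (rule power_subgroup_memI)
          qed
          show "n \<in> L1 <#> generate G {n}" "u \<in> L1 <#> generate G {n}"
            using cyclic_extension(3,4)[OF L1(1) nc] u by blast+
        qed
        then have "u [^] p \<otimes> (inv (u [^] p) \<otimes> inv (n [^] p) \<otimes> (n \<otimes> u) [^] p) \<in> ?P L1"
          by (rule subgroup.m_closed[OF normal_imp_subgroup[OF nP(3)] power_subgroup_memI[OF u]])
        \<comment> \<open>Conjugation by g turns n into n u. Comparing (n u)^p with n^p u^p
          therefore computes [n^p, g].\<close>
        moreover have "n \<otimes> u = inv g \<otimes> n \<otimes> inv (inv g)"
          using nc g by (simp add: u_def group_word_simps)
        then have "(n \<otimes> u) [^] p = inv g \<otimes> n [^] p \<otimes> g"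
          using conj_nat_pow[OF nc inv_closed[OF g]] g by simp
        ultimately show ?thesis
          using nc g uc by (simp add: group_word_simps)
      qed
      then show "n [^] p \<in> centralizer_mod G (carrier G) (?P L1)"
        using nc by (simp add: centralizer_mod_def)
    qed
    moreover have "?I L (p - 2) \<subseteq> ?P M"
    proof (rule iterated_commutator_subset_of_card[OF nP(1) L(1)])
      show "?P M \<subseteq> L"
        by (intro power_subgroup_leI[OF Ls] pow_p_mem_of_index_p[OF L(1) Ms L(2,3)])
      show "card L \<le> p ^ (p - 2) * card (?P M)"
        using boundM L(3) by (intro cancel) simp
    qed
    ultimately show ?thesis by (intro finish) blast
  next
    case False
    let ?C = "commutator_subgroup G M (carrier G)"
    have nC: "?C \<lhd> G" by (intro normal_commutator_subgroup M normal_self)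
    have Mc: "M \<subseteq> carrier G" by (rule subgroup.subset[OF Ms])
    have "\<not> ?C \<subseteq> L1"
      using False commutator_subgroup_subset_iff[OF Mc L1(1)] by simp
    then obtain y where y: "y \<in> ?C" "y \<notin> L1" by blast
    have "?C \<subseteq> L"
      using commutator_subset_of_card[OF L(1) M L(2)] L(3) commutator_subgroup_subset_iff[OF Mc L(1)]
      by simp
    have CU: "?C \<subseteq> upper_central_mod G (?P L) (p - 2)"
      using hyp iterated_commutator_subset_iff[OF nC nP(2), of "p - 2"]
        iterated_commutator_add[of M 1 "p - 2"] p1 by simp
    have "?I L1 (p - 2) \<subseteq> ?P L"
      by (intro iterated_commutator_subset_of_card nP L1(1) L1c \<open>?P L \<subseteq> L1\<close>)
    then have L1U: "L1 \<subseteq> upper_central_mod G (?P L) (p - 2)"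
      using iterated_commutator_subset_iff[OF L1(1) nP(2)] by simp
    have "L \<subseteq> upper_central_mod G (?P L) (p - 2)"
      using subgroup_of_index_le_p[OF Ls L1s
          normal_imp_subgroup[OF normal_upper_central_mod[OF nP(2)]] _ L1(2) L1U, of y]
        L1(3) y \<open>?C \<subseteq> L\<close> CU by auto
    then have "?I L (p - 2) \<subseteq> ?P L"
      using iterated_commutator_subset_iff[OF L(1) nP(2)] by simp
    then show ?thesis using PL by (intro finish) blast
  qed
qed

text \<open>If M is not N, choose C above M with |C : M| = p; the previous lemma passes from the
  pair (C, M) to (M, L). Only the pairs (N, L) have to be supplied, by \<open>base\<close>.\<close>

lemma iterated_commutator_power_subgroup:
  assumes N: "N \<lhd> G" and ND: "N \<subseteq> iterated_commutator G (carrier G) 1"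
    and bound: "card N \<le> p ^ (p - 1) * card (power_subgroup G N p)"
    and base: "\<And>L. L \<lhd> G \<Longrightarrow> L \<subseteq> N \<Longrightarrow> card N = p * card L \<Longrightarrow>
      iterated_commutator G N (p - 1) \<subseteq> power_subgroup G L p"
    and M: "M \<lhd> G" "M \<subseteq> N" and L: "L \<lhd> G" "L \<subseteq> M" "card M = p * card L"
  shows "iterated_commutator G M (p - 1) \<subseteq> power_subgroup G L p"
  using M L
proof (induction "card N - card M" arbitrary: M L rule: less_induct)
  case less
  show ?case
  proof (cases "M = N")
    case False
    then obtain C where C: "C \<lhd> G" "M \<subset> C" "C \<subseteq> N" "card C = p * card M"
      using chief_factor_above[OF less.prems(1) N] less.prems(2) by blast
    have fin: "finite N" "finite C"
      using N C(1) finite_subgroup normal_imp_subgroup by auto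
    have "card N - card C < card N - card M"
      using psubset_card_mono[OF fin(2) C(2)] card_mono[OF fin(1) C(3)] by linarith
    from less.hyps[OF this C(1)] have "iterated_commutator G C (p - 1) \<subseteq> power_subgroup G M p"
      using C(2-4) less.prems(1) by blast
    then show ?thesis
      using C ND less.prems card_power_subgroup_bound[OF N ND bound C(1,3)]
      by (intro iterated_commutator_power_subgroup_step[of C M L]) auto
  qed (use less.prems base in simp)
qed

end

section \<open>Commutators with a fixed element\<close>

context finite_p_group
begin

text \<open>Count non-identity elements: a proper subgroup has at most |G|/p - 1 of them, so p such
  subgroups have at most |G| - p, fewer than the |G| - 1 of G.\<close>

lemma proper_subgroups_not_cover:
  assumes fin: "finite \<E>" and card: "card \<E> \<le> p"
    and proper: "\<And>E. E \<in> \<E> \<Longrightarrow> subgroup E G \<and> E \<noteq> carrier G"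
  shows "\<exists>x \<in> carrier G. \<forall>E \<in> \<E>. x \<notin> E"
proof -
  let ?U = "\<Union>E \<in> \<E>. E - {\<one>}"
  have sub: "subgroup (carrier G) G" by (rule subgroup_self)
  have bound: "p * card (E - {\<one>}) \<le> card (carrier G) - p" if "E \<in> \<E>" for E
  proof -
    have E: "subgroup E G" "E \<subset> carrier G"
      using proper[OF that] subgroup.subset by blast+
    have "card (E - {\<one>}) = card E - 1"
      using subgroup.one_closed[OF E(1)] finite_subgroup[OF E(1)] by simp
    then show ?thesis
      using card_proper_subgroup[OF sub E] by (simp add: diff_mult_distrib2)
  qed
  have "card ?U \<le> (\<Sum>E \<in> \<E>. card (E - {\<one>}))"
    by (rule card_UN_le[OF fin])
  then have "p * card ?U \<le> (\<Sum>E \<in> \<E>. p * card (E - {\<one>}))"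
    by (simp flip: sum_distrib_left)
  also have "\<dots> \<le> (\<Sum>E \<in> \<E>. card (carrier G) - p)"
    by (intro sum_mono bound)
  also have "\<dots> \<le> p * (card (carrier G) - p)"
    using card by simp
  finally have U: "card ?U \<le> card (carrier G) - p"
    using p_pos by simp
  \<comment> \<open>A member of the family is needed to know p \<le> |G|. For the empty family G may
    be trivial, and the identity itself serves as x.\<close>
  have "card (insert \<one> ?U) < card (carrier G)" if "\<E> \<noteq> {}"
  proof -
    obtain E where E: "E \<in> \<E>" using \<open>\<E> \<noteq> {}\<close> by blast
    then have "subgroup E G" "E \<subset> carrier G"
      using proper[OF E] subgroup.subset by blast+
    then have "p * card E \<le> card (carrier G)" "card E > 0"
      using card_proper_subgroup[OF sub] card_subgroup_pos by auto
    then have "p \<le> card (carrier G)"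
      by (metis One_nat_def Suc_leI dual_order.trans mult.right_neutral mult_le_mono2)
    then show ?thesis
      using U p_ge_2 card_insert_le_m1[of "Suc (card ?U)" ?U \<one>] by simp
  qed
  moreover have "finite (insert \<one> ?U)"
    using fin proper finite_subgroup by auto
  ultimately have "\<not> carrier G \<subseteq> insert \<one> ?U" if "\<E> \<noteq> {}"
    using that card_mono[of "insert \<one> ?U" "carrier G"] by auto
  then show ?thesis
    using one_closed by (cases "\<E> = {}") blast+
qed

lemma commutator_mult_right:
  "x \<in> carrier G \<Longrightarrow> h \<in> carrier G \<Longrightarrow> g \<in> carrier G \<Longrightarrow>
    commutator G x (h \<otimes> g) =
      commutator G x g \<otimes> commutator G x h \<otimes> commutator G (commutator G x h) g"
  by (simp add: group_word_simps)

text \<open>The correction in [x, h^(j+1)] is [[x, h^j], h]. It lies in K because [x, h^j] is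
  congruent to [x, h]^j, which is central modulo K.\<close>

lemma commutator_nat_pow_mod:
  assumes K: "K \<lhd> G" and x: "x \<in> carrier G" and h: "h \<in> carrier G"
    and y: "commutator G x h \<in> centralizer_mod G (carrier G) K"
  shows "inv (commutator G x h [^] (j :: nat)) \<otimes> commutator G x (h [^] j) \<in> K"
proof (induction j)
  case 0
  then show ?case
    using x subgroup.one_closed[OF normal_imp_subgroup[OF K]] by (simp add: commutator_def)
next
  case (Suc j)
  let ?Z = "centralizer_mod G (carrier G) K"
  define y where "y = commutator G x h"
  define t where "t = commutator G x (h [^] j)"
  have Ks: "subgroup K G" and Zs: "subgroup ?Z G"
    using K normal_centralizer_mod by (auto intro: normal_imp_subgroup)
  have c: "y \<in> carrier G" "t \<in> carrier G" using x h by (auto simp: y_def t_def)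
  have k: "inv (y [^] j) \<otimes> t \<in> K" using Suc by (simp add: y_def t_def)
  have "y [^] j \<otimes> (inv (y [^] j) \<otimes> t) \<in> ?Z"
    using subgroup.m_closed[OF Zs subgroup_nat_pow_closed[OF Zs y]
        subsetD[OF centralizer_mod_incl[OF K] k]] by (simp add: y_def)
  then have t: "t \<in> ?Z" using c by (simp add: mult_inv_cancel)
  have "commutator G x (h [^] Suc j) = y \<otimes> t \<otimes> commutator G t h"
    using commutator_mult_right[OF x nat_pow_closed[OF h, of j] h] by (simp add: y_def t_def)
  then have "inv (y [^] Suc j) \<otimes> commutator G x (h [^] Suc j) =
      (inv (y [^] j) \<otimes> t) \<otimes> commutator G t h"
    using c h nat_pow_Suc2[OF c(1)] by (simp add: m_assoc inv_mult_group mult_inv_cancel del: nat_pow_Suc)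
  moreover have "commutator G t h \<in> K" using t h by (simp add: centralizer_mod_def)
  ultimately show ?case
    using k subgroup.m_closed[OF Ks] by (simp add: y_def)
qed

text \<open>Lifts a solution of \<open>[x, g] = c\<close> from \<open>G / K'\<close> to \<open>G / K\<close>, where
  \<open>K' = \<langle>[x, h]\<rangle>K\<close> is central modulo \<open>K\<close>.\<close>

lemma commutator_descent:
  assumes x: "x \<in> carrier G" and D: "subgroup D G" and N: "N \<lhd> G" and R: "R \<subseteq> N"
    and step: "\<And>K. K \<lhd> G \<Longrightarrow> A \<subseteq> K \<Longrightarrow> K \<subseteq> N \<Longrightarrow> \<not> R \<subseteq> K \<Longrightarrow>
      (\<And>K' c. K' \<lhd> G \<Longrightarrow> K \<subset> K' \<Longrightarrow> K' \<subseteq> N \<Longrightarrow> c \<in> R \<Longrightarrow>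
        \<exists>g \<in> D. inv c \<otimes> commutator G x g \<in> K') \<Longrightarrow>
      \<exists>h \<in> D. commutator G x h \<in> N \<and> commutator G x h \<notin> K \<and>
        commutator G x h \<in> centralizer_mod G (carrier G) K"
    and K: "K \<lhd> G" "A \<subseteq> K" "K \<subseteq> N" and c: "c \<in> R"
  shows "\<exists>g \<in> D. inv c \<otimes> commutator G x g \<in> K"
  using K c
proof (induction "card N - card K" arbitrary: K c rule: less_induct)
  case less
  have Ks: "subgroup K G" and Ns: "subgroup N G"
    using less.prems N by (auto intro: normal_imp_subgroup)
  show ?case
  proof (cases "R \<subseteq> K")
    case True
    then have "c \<in> K" using less.prems(4) by blast
    then have "inv c \<otimes> commutator G x \<one> \<in> K"
      using x subgroup.m_inv_closed[OF Ks] subgroup.mem_carrier[OF Ks, of c]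
      by (simp add: commutator_def)
    then show ?thesis using subgroup.one_closed[OF D] by blast
  next
    case False
    \<comment> \<open>The induction hypothesis is handed on to \<open>step\<close>: below N^p the
      required h is the p-th power of a solution modulo a larger K'.\<close>
    have IH: "\<exists>g \<in> D. inv c \<otimes> commutator G x g \<in> K'"
      if K': "K' \<lhd> G" "K \<subset> K'" "K' \<subseteq> N" and c: "c \<in> R" for K' c
    proof -
      have fin: "finite N" "finite K'"
        using Ns K'(1) finite_subgroup normal_imp_subgroup by auto
      have "card N - card K' < card N - card K"
        using psubset_card_mono[OF fin(2) K'(2)] card_mono[OF fin(1) K'(3)] by linarith
      from less.hyps[OF this K'(1) _ K'(3) c] show ?thesis using K'(2) less.prems(2) by blast
    qed
    obtain h where h: "h \<in> D" "commutator G x h \<in> N" "commutator G x h \<notin> K"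
      "commutator G x h \<in> centralizer_mod G (carrier G) K"
      using step[OF less.prems(1-3) False IH] by blast
    define y where "y = commutator G x h"
    have hc: "h \<in> carrier G" by (rule subgroup.mem_carrier[OF D h(1)])
    have yc: "y \<in> carrier G" using x hc by (simp add: y_def)
    let ?Z = "centralizer_mod G (carrier G) K"
    let ?K' = "K <#> generate G {y}"
    note ext = cyclic_extension[OF less.prems(1) yc]
    have Z: "subgroup ?Z G" using subgroup_centralizer_mod[OF less.prems(1)] by simp
    have KZ: "K \<subseteq> ?Z" by (rule centralizer_mod_incl[OF less.prems(1)])
    have "?K' \<subseteq> ?Z"
      using h(4) by (intro set_mult_least Z KZ generate_subgroup_incl) (auto simp: y_def)
    then have "?K' \<lhd> G"
      by (rule normal_between_centralizer_mod[OF less.prems(1) ext(2,3)])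
    moreover have "K \<subset> ?K'" using ext(3,4) h(3) by (auto simp: y_def)
    moreover have "?K' \<subseteq> N"
      using h(2) less.prems(3) by (intro set_mult_least Ns generate_subgroup_incl) (auto simp: y_def)
    ultimately obtain g where g: "g \<in> D" "inv c \<otimes> commutator G x g \<in> ?K'"
      using IH less.prems(4) by blast
    have gc: "g \<in> carrier G" by (rule subgroup.mem_carrier[OF D g(1)])
    have cc: "c \<in> carrier G" 
      by (rule subgroup.mem_carrier[OF Ns subsetD[OF R less.prems(4)]])
    obtain k and i :: nat where k: "k \<in> K" "inv c \<otimes> commutator G x g = k \<otimes> y [^] i"
      using g(2) unfolding ext(1) by blast
    have kc: "k \<in> carrier G" by (rule subgroup.mem_carrier[OF Ks k(1)])
    \<comment> \<open>A natural number in the role of -i: i + j is a multiple of the group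
      order.\<close>
    define j where "j = i * (order G - 1)"
    have "order G > 0" using finite_carrier order_gt_0_iff_finite by simp
    then have "i + j = order G * i" by (cases "order G") (simp_all add: j_def)
    then have yij: "y [^] i \<otimes> y [^] j = \<one>"
      using yc pow_order_eq_1[OF yc] by (simp add: nat_pow_mult flip: nat_pow_pow)
    define t where "t = commutator G x (h [^] j)"
    have tc: "t \<in> carrier G" using x hc by (simp add: t_def)
    have k1: "inv (y [^] j) \<otimes> t \<in> K"
      unfolding y_def t_def by (rule commutator_nat_pow_mod[OF less.prems(1) x hc h(4)])
    then have "y [^] j \<otimes> (inv (y [^] j) \<otimes> t) \<in> ?Z"
      using subgroup.m_closed[OF Z subgroup_nat_pow_closed[OF Z h(4)] subsetD[OF KZ k1]]
      by (simp add: y_def)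
    then have "t \<in> ?Z" using yc tc by (simp add: mult_inv_cancel)
    then have k2: "commutator G t g \<in> K" using gc by (simp add: centralizer_mod_def)
    have "inv c \<otimes> commutator G x (h [^] j \<otimes> g) =
        (inv c \<otimes> commutator G x g) \<otimes> t \<otimes> commutator G t g"
      unfolding t_def using x gc hc cc
      by (subst commutator_mult_right) (simp_all add: m_assoc)
    also have "\<dots> = k \<otimes> (y [^] i \<otimes> y [^] j) \<otimes> (inv (y [^] j) \<otimes> t) \<otimes> commutator G t g"
      unfolding k(2) using kc yc tc gc by (simp add: m_assoc mult_inv_cancel)
    also have "\<dots> \<in> K"
      unfolding yij using k(1) k1 k2 kc by (simp add: subgroup.m_closed[OF Ks])
    finally show ?thesis
      using subgroup.m_closed[OF D subgroup_nat_pow_closed[OF D h(1)] g(1)] by blast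
  qed
qed

lemma pow_mem_of_commuting_mod:
  assumes K: "K \<lhd> G" and c: "c \<in> carrier G" and z: "z \<in> carrier G"
    and comm: "commutator G c z \<in> K" and zn: "z [^] (n :: nat) \<in> K" and czn: "(c \<otimes> z) [^] n \<in> K"
  shows "c [^] n \<in> K"
proof -
  interpret Q: finite_p_group "G Mod K" p by (rule finite_p_group_FactGroup[OF K])
  interpret \<phi>: group_hom G "G Mod K" "\<lambda>a. K #> a" by (rule group_hom_FactGroup[OF K])
  note iff = rcos_eq_iff[OF normal_imp_subgroup[OF K]]
  let ?f = "\<lambda>a. K #> a"
  have fc: "?f c \<in> carrier (G Mod K)" "?f z \<in> carrier (G Mod K)"
    using c z \<phi>.hom_closed by blast+
  have "c \<otimes> z = z \<otimes> c \<otimes> commutator G c z"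
    using c z by (simp add: group_word_simps)
  then have "?f (c \<otimes> z) = ?f (z \<otimes> c) \<otimes>\<^bsub>G Mod K\<^esub> ?f (commutator G c z)"
    using c z by (metis \<phi>.hom_mult commutator_closed m_closed)
  also have "?f (commutator G c z) = \<one>\<^bsub>G Mod K\<^esub>"
    using iff[of "commutator G c z"] comm c z by simp
  finally have "?f c \<otimes>\<^bsub>G Mod K\<^esub> ?f z = ?f z \<otimes>\<^bsub>G Mod K\<^esub> ?f c"
    using c z fc by (metis \<phi>.hom_closed \<phi>.hom_mult Q.r_one m_closed)
  from Q.pow_mult_distrib[OF this fc]
  have "?f ((c \<otimes> z) [^] n) = ?f (c [^] n) \<otimes>\<^bsub>G Mod K\<^esub> ?f (z [^] n)"
    using c z by (metis \<phi>.hom_mult \<phi>.hom_nat_pow m_closed)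
  then have "?f (c [^] n) = \<one>\<^bsub>G Mod K\<^esub>"
    using iff[of "(c \<otimes> z) [^] n"] iff[of "z [^] n"] zn czn c z
    by (metis Q.r_one \<phi>.hom_closed m_closed nat_pow_closed one_FactGroup)
  then show ?thesis using iff[of "c [^] n"] c by simp
qed

text \<open>Minimality of M yields L^p \<le> K. Thus an error in L that commutes with c modulo K
  does not affect whether the p-th power of c lies in K.\<close>

lemma minimal_power_not_subset:
  assumes N: "N \<lhd> G" and K: "K \<lhd> G" "K \<subseteq> N" and not: "\<not> power_subgroup G N p \<subseteq> K"
  obtains M L c where "M \<lhd> G" "M \<subseteq> N" "L \<lhd> G" "K \<subseteq> L" "L \<subseteq> M" "card M = p * card L"
    "power_subgroup G L p \<subseteq> K" "c \<in> M" "c [^] p \<notin> K"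
proof -
  let ?Q = "\<lambda>M. M \<lhd> G \<and> K \<subseteq> M \<and> M \<subseteq> N \<and> \<not> power_subgroup G M p \<subseteq> K"
  obtain M where M: "?Q M" and min: "\<And>D. ?Q D \<Longrightarrow> card M \<le> card D"
    using ex_has_least_nat[of ?Q N card] N K not by blast
  have Ks: "subgroup K G" using K by (simp add: normal_imp_subgroup)
  have Mn: "M \<lhd> G" using M by simp
  have "K \<subset> M" using M power_subgroup_incl[OF Ks] by blast
  then obtain L where L: "L \<lhd> G" "K \<subseteq> L" "L \<subset> M" "card M = p * card L"
    using chief_factor_below[OF K(1) Mn] by blast
  from Mn have "finite M" using finite_subgroup[OF normal_imp_subgroup] by simp
  then have "card L < card M" using L(3) by (rule psubset_card_mono)
  then have "\<not> ?Q L" using min[of L] by linarith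
  then have "power_subgroup G L p \<subseteq> K" using L M by blast
  moreover obtain c where "c \<in> M" "c [^] p \<notin> K"
    using M power_subgroup_leI[OF Ks, of M p] by blast
  ultimately show thesis using that M L by blast
qed

text \<open>Put u = [x, k] and let a be the conjugate x^-1 k x, so that a u = k. Modulo K the p-th
  power of a u is a^p u^p, hence [x, k^p] = a^-p k^p is congruent to u^p. This is central modulo K
  because |M^p : L^p| \<le> p. Writing u = c z, the error z lies in L and is central modulo K, so
  z^p lies in K and u^p stays outside K together with c^p.\<close>

lemma commutator_p_power:
  assumes x: "x \<in> carrier G"
    and M: "M \<lhd> G" "M \<subseteq> iterated_commutator G (carrier G) 1"
    and bound: "card M \<le> p ^ (p - 1) * card (power_subgroup G M p)"
    and L: "L \<lhd> G" "L \<subseteq> M" "card M = p * card L"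
    and K: "K \<lhd> G" "K \<subseteq> L" "power_subgroup G L p \<subseteq> K"
    and e: "e \<le> 1" "k \<in> iterated_commutator G (carrier G) e"
    and MK: "iterated_commutator G M (p - 1 + e) \<subseteq> K"
    and c: "c \<in> M" "c [^] p \<notin> K"
    and ck: "inv c \<otimes> commutator G x k \<in> power_subgroup G M p <#> K"
  shows "commutator G x (k [^] p) \<in> M" "commutator G x (k [^] p) \<notin> K"
    "commutator G x (k [^] p) \<in> centralizer_mod G (carrier G) K"
proof -
  let ?P = "\<lambda>A. power_subgroup G A p" and ?Z = "centralizer_mod G (carrier G) K"
  have Ms: "subgroup M G" and Ls: "subgroup L G" and Ks: "subgroup K G" and Zs: "subgroup ?Z G"
    using M(1) L(1) K(1) normal_centralizer_mod by (auto intro: normal_imp_subgroup)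
  have "card (?P M) \<le> p * card (?P L)"
    by (rule card_power_subgroup_of_index_p[OF M L bound])
  then have "?P M \<subseteq> centralizer_mod G (carrier G) (?P L)"
    by (intro commutator_subset_of_card normal_power_subgroup power_subgroup_mono M L)
  then have PZ: "?P M \<subseteq> ?Z" using K(3) by (auto simp: centralizer_mod_def)
  have KZ: "K \<subseteq> ?Z" by (rule centralizer_mod_incl[OF K(1)])
  have PL: "?P M \<subseteq> L"
    by (intro power_subgroup_leI[OF Ls] pow_p_mem_of_index_p[OF L(1) Ms L(2,3)])
  have kc: "k \<in> carrier G"
    by (rule normal_carrier[OF normal_iterated_commutator[OF normal_self] e(2)])
  have cc: "c \<in> carrier G" by (rule subgroup.mem_carrier[OF Ms c(1)])
  define u where "u = commutator G x k"
  define z where "z = inv c \<otimes> u"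
  have uc: "u \<in> carrier G" using x kc by (simp add: u_def)
  have zc: "z \<in> carrier G" using uc cc by (simp add: z_def)
  have ucz: "u = c \<otimes> z" using uc cc by (simp add: z_def mult_inv_cancel)
  have zK': "z \<in> ?P M <#> K" using ck by (simp add: z_def u_def)
  have zL: "z \<in> L" using zK' set_mult_least[OF Ls PL K(2)] by blast
  have zZ: "z \<in> ?Z" using zK' set_mult_least[OF Zs PZ KZ] by blast
  have zp: "z [^] p \<in> K" using power_subgroup_memI[OF zL, of p] K(3) by blast
  have "commutator G z c \<in> K" using zZ cc by (simp add: centralizer_mod_def)
  then have "commutator G c z \<in> K" by (rule commutator_swap_mem[OF Ks zc cc])
  then have up: "u [^] p \<notin> K"
    using pow_mem_of_commuting_mod[OF K(1) cc zc _ zp] c(2) ucz by blast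
  have uM: "u \<in> M"
    unfolding ucz using zL L(2) by (intro subgroup.m_closed[OF Ms] c(1)) blast
  define a where "a = inv x \<otimes> k \<otimes> x"
  have ac: "a \<in> carrier G" using x kc by (simp add: a_def)
  have au: "a \<otimes> u = k" using x kc by (simp add: a_def u_def group_word_simps)
  then have a: "a = k \<otimes> inv u" using ac uc kc by (metis inv_solve_right)
  note ext = cyclic_extension[OF M(1) kc]
  have uS: "u \<in> M <#> generate G {k}" using uM ext(3) by blast
  have aS: "a \<in> M <#> generate G {k}"
    unfolding a by (intro subgroup.m_closed[OF ext(2)] subgroup.m_inv_closed[OF ext(2)] uS ext(4))
  have Me: "M \<subseteq> iterated_commutator G (carrier G) e"
    using M(2) e(1) iterated_commutator_antimono[OF normal_self e(1)] by blast
  have "commutator_subgroup G M (carrier G) \<subseteq> L"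
    using commutator_subset_of_card[OF L(1) M(1) L(2)] L(3)
      commutator_subgroup_subset_iff[OF subgroup.subset[OF Ms] L(1)] by simp
  then have "iterated_commutator G M (Suc e) \<subseteq> L"
    using iterated_commutator_antimono[OF M(1), of 1 "Suc e"] by auto
  then have K2: "h [^] p \<in> K" if "h \<in> iterated_commutator G M (Suc e)" for h
    using that power_subgroup_memI[of h L p] K(3) by blast
  have "inv (u [^] p) \<otimes> inv (a [^] p) \<otimes> (a \<otimes> u) [^] p \<in> K"
    by (rule p_power_mult_mod[OF M(1) Me e(2) Ks MK K2 aS uS])
  moreover have "a [^] p = inv x \<otimes> k [^] p \<otimes> x"
    using conj_nat_pow[OF kc inv_closed[OF x], of p] x by (simp add: a_def)
  ultimately have \<kappa>: "inv (u [^] p) \<otimes> commutator G x (k [^] p) \<in> K" (is "?\<kappa> \<in> K")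
    using x kc uc unfolding au by (simp add: group_word_simps)
  have y: "commutator G x (k [^] p) = u [^] p \<otimes> ?\<kappa>"
    using x kc uc by (simp add: mult_inv_cancel)
  have uPM: "u [^] p \<in> ?P M" by (rule power_subgroup_memI[OF uM])
  show "commutator G x (k [^] p) \<in> M"
    by (subst y, rule subgroup.m_closed[OF Ms]) (use uPM PL L(2) K(2) \<kappa> in auto)
  show "commutator G x (k [^] p) \<in> ?Z"
    by (subst y, rule subgroup.m_closed[OF Zs]) (use uPM PZ KZ \<kappa> in auto)
  show "commutator G x (k [^] p) \<notin> K"
  proof
    assume "commutator G x (k [^] p) \<in> K"
    then have "commutator G x (k [^] p) \<otimes> inv ?\<kappa> \<in> K"
      by (rule subgroup.m_closed[OF Ks _ subgroup.m_inv_closed[OF Ks \<kappa>]])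
    then show False using up x kc uc by (simp add: inv_mult_group mult_inv_cancel)
  qed
qed

text \<open>Used in contrapositive form, to see that a centralizer which x should avoid is
  proper.\<close>

lemma lower_central_subset_of_centralizer_mod:
  assumes Q: "Q \<lhd> G" and E: "centralizer_mod G (iterated_commutator G (carrier G) j) Q = carrier G"
  shows "iterated_commutator G (carrier G) (Suc j) \<subseteq> Q"
proof -
  have Qs: "subgroup Q G" using Q by (rule normal_imp_subgroup)
  have "commutator G h g \<in> Q" if "h \<in> iterated_commutator G (carrier G) j" "g \<in> carrier G" for h g
  proof (rule commutator_swap_mem[OF Qs that(2)])
    show "h \<in> carrier G"
      by (rule normal_carrier[OF normal_iterated_commutator[OF normal_self] that(1)])
    show "commutator G g h \<in> Q"
      using that E by (auto simp: centralizer_mod_def)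
  qed
  then show ?thesis by (simp add: commutator_subgroup_leI[OF Qs])
qed

text \<open>Here \<open>\<gamma> i\<close> is \<open>\<gamma>\<^sub>i\<^sub>+\<^sub>1(G)\<close>. If \<open>\<gamma> p \<subseteq> (N2)\<^sup>p\<close>, then \<open>[M, G, \<dots>, G] \<subseteq> L\<^sup>p\<close> (with \<open>p - 1\<close> copies of \<open>G\<close>) holds for all
  \<open>L\<close> of index \<open>p\<close> in \<open>M\<close>, and \<open>e = 0\<close> suffices. Otherwise \<open>N2 = \<gamma> 2\<close>, and every normal subgroup
  \<open>M\<close> of \<open>G\<close> properly contained in \<open>N\<close> lies in \<open>\<gamma> 2\<close>; this allows \<open>e = 1\<close>. The subgroup \<open>E'\<close>
  is needed only for \<open>M = N\<close> in this second case.\<close>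

theorem uniserial_derived_commutators:
  fixes d :: nat
  defines "\<gamma> \<equiv> iterated_commutator G (carrier G)"
  defines "P \<equiv> power_subgroup G (\<gamma> 1) p"
  assumes card_N: "card (\<gamma> 1) = p ^ d * card P" and d: "d \<le> p - 1"
    and uniserial: "\<And>i. 1 \<le> i \<Longrightarrow> card (\<gamma> i <#> P) \<le> p * card (\<gamma> (Suc i) <#> P)"
  shows "\<exists>x \<in> carrier G. \<forall>c \<in> \<gamma> 1. \<exists>g \<in> carrier G. commutator G x g = c"
proof -
  let ?N = "\<gamma> 1" and ?\<P> = "\<lambda>A. power_subgroup G A p"
  have n\<gamma>: "\<gamma> i \<lhd> G" for i
    unfolding \<gamma>_def by (intro normal_iterated_commutator normal_self)
  have s\<gamma>: "subgroup (\<gamma> i) G" for i by (rule normal_imp_subgroup[OF n\<gamma>])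
  have nP: "P \<lhd> G" unfolding P_def by (rule normal_power_subgroup[OF n\<gamma>])
  have sP: "subgroup P G" by (rule normal_imp_subgroup[OF nP])
  have PN: "P \<subseteq> ?N" unfolding P_def by (rule power_subgroup_incl[OF s\<gamma>])
  have \<gamma>_antimono: "\<gamma> j \<subseteq> \<gamma> i" if "i \<le> j" for i j
    unfolding \<gamma>_def by (rule iterated_commutator_antimono[OF normal_self that])
  have \<gamma>_add: "iterated_commutator G (\<gamma> i) j = \<gamma> (i + j)" for i j
    unfolding \<gamma>_def by (rule iterated_commutator_add)
  have \<gamma>_comm: "commutator G h g \<in> \<gamma> (Suc i)" if "h \<in> \<gamma> i" "g \<in> carrier G" for h g i
    using that unfolding \<gamma>_def by (rule iterated_commutator_memI)
  have \<gamma>_comm': "commutator G g h \<in> \<gamma> (Suc i)" if "h \<in> \<gamma> i" "g \<in> carrier G" for h g i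
    using commutator_swap_mem[OF s\<gamma> normal_carrier[OF n\<gamma> that(1)] that(2) \<gamma>_comm[OF that]] .
  have \<gamma>P: "\<gamma> i <#> P \<lhd> G" for i by (rule normal_set_mult[OF n\<gamma> nP])
  have \<gamma>d: "\<gamma> (Suc d) \<subseteq> P"
    using iterated_commutator_subset_of_card[OF nP n\<gamma> PN, of d] card_N \<gamma>_add[of 1 d] by simp
  have bound: "card ?N \<le> p ^ (p - 1) * card P"
    using card_N power_increasing[OF d, of p] p_pos by simp
  have p1: "Suc (p - 1) = p" using p_pos by simp
  have \<gamma>p: "\<gamma> p \<subseteq> P"
    using iterated_commutator_subset_of_card[OF nP n\<gamma> PN bound] \<gamma>_add[of 1 "p - 1"] p1 by simp
  have NN: "?N \<subseteq> iterated_commutator G (carrier G) 1" by (simp add: \<gamma>_def)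

  define N2 where "N2 = \<gamma> 2 <#> P"
  have nN2: "N2 \<lhd> G" unfolding N2_def by (rule \<gamma>P)
  have sN2: "subgroup N2 G" by (rule normal_imp_subgroup[OF nN2])
  have N2N: "N2 \<subseteq> ?N"
    unfolding N2_def using \<gamma>_antimono[of 1 2] by (intro set_mult_least s\<gamma> PN) auto
  have N2_least: "N2 \<subseteq> L" if L: "L \<lhd> G" "L \<subseteq> ?N" "card ?N = p * card L" for L
    unfolding N2_def
  proof (rule set_mult_least)
    show sL: "subgroup L G" by (rule normal_imp_subgroup[OF L(1)])
    show "\<gamma> 2 \<subseteq> L"
      using commutator_subset_of_card[OF L(1) n\<gamma> L(2)] L(3) \<gamma>_add[of 1 1]
        commutator_subgroup_subset_iff[OF subgroup.subset[OF s\<gamma>] L(1), of 1]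
      by (simp add: numeral_2_eq_2)
    show "P \<subseteq> L"
      unfolding P_def by (intro power_subgroup_leI sL pow_p_mem_of_index_p[OF L(1) s\<gamma> L(2,3)])
  qed

  \<comment> \<open>In the usual numbering \<open>E j\<close> centralizes the j-th lower central
    term modulo the (j+2)-nd times N^p, and \<open>E'\<close> the p-th one modulo N2^p. Members
    equal to G are discarded; each remaining use shows properness on the spot. The count d + 1 \<le>
    p fits \<open>proper_subgroups_not_cover\<close>.\<close>
  define E where "E j = centralizer_mod G (\<gamma> (j - 1)) (\<gamma> (Suc j) <#> P)" for j
  define E' where "E' = centralizer_mod G (\<gamma> (p - 1)) (?\<P> N2)"
  define \<E> where "\<E> = {F \<in> insert E' (E ` {1..d}). F \<noteq> carrier G}"
  have "card \<E> \<le> card (insert E' (E ` {1..d}))"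
    unfolding \<E>_def by (intro card_mono) auto
  also have "\<dots> \<le> Suc (card (E ` {1..d}))" by (rule card_insert_le_m1) simp_all
  also have "\<dots> \<le> Suc d" using card_image_le[of "{1..d}" E] by simp
  finally have card_E: "card \<E> \<le> p" using d p_pos by simp
  have "\<exists>x \<in> carrier G. \<forall>F \<in> \<E>. x \<notin> F"
  proof (rule proper_subgroups_not_cover[OF _ card_E])
    show "subgroup F G \<and> F \<noteq> carrier G" if "F \<in> \<E>" for F
      using that subgroup_centralizer_mod[OF \<gamma>P subgroup.subset[OF s\<gamma>]]
        subgroup_centralizer_mod[OF normal_power_subgroup[OF nN2] subgroup.subset[OF s\<gamma>]]
      unfolding \<E>_def E_def E'_def by auto
  qed (simp add: \<E>_def)
  then obtain x where x: "x \<in> carrier G" and x\<E>: "\<And>F. F \<in> \<E> \<Longrightarrow> x \<notin> F"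
    by blast

  \<comment> \<open>j is the last index with \<open>\<gamma> j\<close> not inside K, so
    \<open>\<gamma> j\<close> is central modulo K, and j \<le> d because
    \<open>\<gamma> (Suc d)\<close> lies in P. Then x is outside \<open>E j\<close>, and
    uniseriality keeps the resulting commutator out of K. The bound i controls where h lies: i = 2
    forces h into N.\<close>
  have above_P: "\<exists>j h. i \<le> j \<and> h \<in> \<gamma> (j - 1) \<and> commutator G x h \<in> \<gamma> j \<and> commutator G x h \<notin> K \<and>
      commutator G x h \<in> centralizer_mod G (carrier G) K"
    if i: "1 \<le> i" and K: "K \<lhd> G" "P \<subseteq> K" "\<not> \<gamma> i \<subseteq> K" for i K
  proof -
    have Ks: "subgroup K G" by (rule normal_imp_subgroup[OF K(1)])
    define n where "n = (LEAST n. \<gamma> n \<subseteq> K)"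
    have ex: "\<gamma> (Suc d) \<subseteq> K" using \<gamma>d K(2) by blast
    then have n: "\<gamma> n \<subseteq> K" unfolding n_def by (rule LeastI)
    have nd: "n \<le> Suc d" unfolding n_def using ex by (rule Least_le)
    have "i < n" using \<gamma>_antimono[of n i] n K(3) by (meson not_le subset_trans)
    then obtain j where j: "n = Suc j" "i \<le> j" by (cases n) auto
    have jK: "\<not> \<gamma> j \<subseteq> K"
      using not_less_Least[of j "\<lambda>n. \<gamma> n \<subseteq> K"] j unfolding n_def by simp
    have QK: "\<gamma> (Suc j) <#> P \<subseteq> K" using n j(1) K(2) by (intro set_mult_least Ks) auto
    have j1: "Suc (j - 1) = j" using i j by simp
    have "E j \<noteq> carrier G"
      using lower_central_subset_of_centralizer_mod[OF \<gamma>P, of "j - 1" "Suc j"] jK QK j1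
      unfolding E_def \<gamma>_def by auto
    then have "E j \<in> \<E>" using i j nd unfolding \<E>_def by auto
    then have "x \<notin> E j" by (rule x\<E>)
    then obtain h where h: "h \<in> \<gamma> (j - 1)" "commutator G x h \<notin> \<gamma> (Suc j) <#> P"
      using x by (auto simp: E_def centralizer_mod_def)
    have y: "commutator G x h \<in> \<gamma> j" using \<gamma>_comm'[OF h(1) x] j1 by simp
    have sub: "subgroup (\<gamma> i <#> P) G" for i by (rule normal_imp_subgroup[OF \<gamma>P])
    have "commutator G x h \<notin> K"
    proof
      assume yK: "commutator G x h \<in> K"
      have "\<gamma> j <#> P \<subseteq> K"
      proof (rule subgroup_of_index_le_p[OF sub sub Ks uniserial _ QK _ yK h(2)])
        show "1 \<le> j" using i j by simp
        show "\<gamma> (Suc j) <#> P \<subseteq> \<gamma> j <#> P" by (intro mono_set_mult \<gamma>_antimono) auto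
        show "commutator G x h \<in> \<gamma> j <#> P" using y set_mult_upper(1)[OF s\<gamma> sP] by blast
      qed
      then show False using jK set_mult_upper(1)[OF s\<gamma> sP] by blast
    qed
    moreover have "commutator G x h \<in> centralizer_mod G (carrier G) K"
      using \<gamma>_comm[OF y] n j(1) normal_carrier[OF n\<gamma> y] by (auto simp: centralizer_mod_def)
    ultimately show ?thesis using h(1) y j(2) by blast
  qed

  \<comment> \<open>Uniseriality at i = 1 gives |N : N2| \<le> p. Taking p-th powers gives |P :
    N2^p| \<le> p, and a normal section of order at most p is central.\<close>
  have central: "P \<subseteq> centralizer_mod G (carrier G) (?\<P> N2)" and N2P: "?\<P> N2 \<subseteq> P"
    and index_P: "card P \<le> p * card (?\<P> N2)" and index_N: "N2 = ?N \<or> card ?N = p * card N2"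
  proof -
    have "card ?N \<le> card (\<gamma> 1 <#> P)"
      using set_mult_upper(1)[OF s\<gamma> sP]
      by (intro card_mono finite_subgroup normal_imp_subgroup[OF \<gamma>P]) auto
    also have "\<dots> \<le> p * card N2"
      using uniserial[of 1] by (simp add: N2_def numeral_2_eq_2)
    finally have "card ?N \<le> p * card N2" .
    then show index_N: "N2 = ?N \<or> card ?N = p * card N2"
      using card_proper_subgroup[OF s\<gamma> sN2, of 1] N2N by fastforce
    show N2P: "?\<P> N2 \<subseteq> P" unfolding P_def by (rule power_subgroup_mono[OF n\<gamma> N2N])
    show index_P: "card P \<le> p * card (?\<P> N2)"
      using index_N
    proof
      assume "card ?N = p * card N2"
      from card_power_subgroup_of_index_p[OF n\<gamma> NN nN2 N2N this] bound show ?thesis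
        by (simp add: P_def)
    qed (use p_pos in \<open>simp add: P_def\<close>)
    show "P \<subseteq> centralizer_mod G (carrier G) (?\<P> N2)"
      by (rule commutator_subset_of_card[OF normal_power_subgroup[OF nN2] nP N2P index_P])
  qed
  have boundM: "card M \<le> p ^ (p - 1) * card (?\<P> M)" if "M \<lhd> G" "M \<subseteq> ?N" for M
    using card_power_subgroup_bound[OF n\<gamma> NN _ that] bound by (simp add: P_def)
  have one: "{\<one>} \<lhd> G" by (rule one_is_normal)
  have solves: "commutator G x g = c" if "inv c \<otimes> commutator G x g \<in> {\<one>}" "c \<in> carrier G" "g \<in> carrier G"
    for c g
    using that x by (metis commutator_closed inv_closed inv_equality inv_inv singletonD)
  have PK': "power_subgroup G M p <#> K \<lhd> G \<and> K \<subset> power_subgroup G M p <#> K \<and>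
      power_subgroup G M p <#> K \<subseteq> ?N"
    if "M \<lhd> G" "M \<subseteq> ?N" "K \<lhd> G" "K \<subseteq> ?N" "c \<in> M" "c [^] p \<notin> K" for M K c
  proof -
    have "K \<subseteq> ?\<P> M <#> K" "?\<P> M \<subseteq> ?\<P> M <#> K"
      using that(1,3) by (intro set_mult_upper normal_imp_subgroup normal_power_subgroup; simp)+
    moreover have "?\<P> M <#> K \<subseteq> ?N"
      using that(2,4) power_subgroup_incl[OF normal_imp_subgroup[OF that(1)], of p]
      by (intro set_mult_least s\<gamma>) auto
    ultimately show ?thesis
      using that(6) power_subgroup_memI[OF that(5), of p]
        normal_set_mult[OF normal_power_subgroup[OF that(1)] that(3)] by blast
  qed

  have "\<exists>g \<in> carrier G. inv c \<otimes> commutator G x g \<in> {\<one>}" if c: "c \<in> ?N" for c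
  proof (cases "\<gamma> p \<subseteq> ?\<P> N2")
    case True
    \<comment> \<open>Every such L contains N2, so \<open>\<gamma> p\<close>, the commutator of N
      with p - 1 copies of G, lies in N2^p and hence in L^p.\<close>
    have base: "iterated_commutator G ?N (p - 1) \<subseteq> ?\<P> L"
      if L: "L \<lhd> G" "L \<subseteq> ?N" "card ?N = p * card L" for L
      using True power_subgroup_mono[OF L(1) N2_least[OF L], of p] \<gamma>_add[of 1 "p - 1"] p1 by auto
    show ?thesis
    proof (rule commutator_descent[OF x subgroup_self n\<gamma> subset_refl _ one _ _ c, where A = "{\<one>}"])
      fix K assume K: "K \<lhd> G" "K \<subseteq> ?N" "\<not> ?N \<subseteq> K"
        and IH: "\<And>K' c. K' \<lhd> G \<Longrightarrow> K \<subset> K' \<Longrightarrow> K' \<subseteq> ?N \<Longrightarrow> c \<in> ?N \<Longrightarrow>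
          \<exists>g \<in> carrier G. inv c \<otimes> commutator G x g \<in> K'"
      show "\<exists>h \<in> carrier G. commutator G x h \<in> ?N \<and> commutator G x h \<notin> K \<and>
        commutator G x h \<in> centralizer_mod G (carrier G) K"
      proof (cases "P \<subseteq> K")
        case True
        then obtain j h where "1 \<le> j" "h \<in> \<gamma> (j - 1)" "commutator G x h \<in> \<gamma> j" "commutator G x h \<notin> K"
          "commutator G x h \<in> centralizer_mod G (carrier G) K"
          using above_P[of 1 K] K by blast
        then show ?thesis using \<gamma>_antimono[of 1 j] normal_carrier[OF n\<gamma>] by blast
      next
        case False
        obtain M L c where M: "M \<lhd> G" "M \<subseteq> ?N" and L: "L \<lhd> G" "K \<subseteq> L" "L \<subseteq> M" "card M = p * card L"
          "?\<P> L \<subseteq> K" and c: "c \<in> M" "c [^] p \<notin> K"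
          using minimal_power_not_subset[OF n\<gamma> K(1,2)] False unfolding P_def by blast
        obtain g where g: "g \<in> carrier G" "inv c \<otimes> commutator G x g \<in> ?\<P> M <#> K"
          using IH[of "?\<P> M <#> K" c] PK'[OF M K(1,2) c] c(1) M(2) by blast
        have "iterated_commutator G M (p - 1) \<subseteq> K"
          using iterated_commutator_power_subgroup[OF n\<gamma> NN boundM[OF n\<gamma> subset_refl] base M L(1,3,4)]
            L(5) by blast
        then have "commutator G x (g [^] p) \<in> M" "commutator G x (g [^] p) \<notin> K"
          "commutator G x (g [^] p) \<in> centralizer_mod G (carrier G) K"
          using commutator_p_power[OF x M(1) _ boundM[OF M] L(1,3,4) K(1) L(2,5), of 0 g c] M(2) NN g c
          by auto
        then show ?thesis using M(2) g(1) by blast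
      qed
    qed (use subgroup.one_closed[OF s\<gamma>] in auto)
  next
    case False
    then obtain y where y: "y \<in> \<gamma> p" "y \<notin> ?\<P> N2" by blast
    have "N2 \<noteq> ?N" using False \<gamma>p by (auto simp: P_def)
    then have index_N: "card ?N = p * card N2" using index_N by blast
    have snP: "subgroup (?\<P> N2) G" and s\<gamma>pP: "subgroup (\<gamma> i <#> ?\<P> N2) G" for i
      by (intro normal_imp_subgroup normal_set_mult normal_power_subgroup n\<gamma> nN2)+
    note up = set_mult_upper[OF s\<gamma> snP]
    have \<gamma>p2: "\<gamma> p \<subseteq> \<gamma> 2" by (rule \<gamma>_antimono[OF p_ge_2])
    \<comment> \<open>Since |P : N2^p| \<le> p, the single element y of \<open>\<gamma> p\<close>
      outside N2^p generates P modulo N2^p.\<close>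
    have "P \<subseteq> \<gamma> p <#> ?\<P> N2"
      by (rule subgroup_of_index_le_p[OF sP snP s\<gamma>pP index_P N2P up(2) _ _ y(2)])
        (use y \<gamma>p up in blast)+
    also have "\<dots> \<subseteq> \<gamma> 2 <#> ?\<P> N2" by (intro mono_set_mult \<gamma>p2) simp
    finally have P2: "P \<subseteq> \<gamma> 2 <#> ?\<P> N2" .
    have \<gamma>2N2: "\<gamma> 2 \<subseteq> N2" unfolding N2_def by (rule set_mult_upper(1)[OF s\<gamma> sP])
    \<comment> \<open>Frattini-type argument: a normal Y of index p in N2 above
      \<open>\<gamma> 2\<close> would contain N2^p, hence P, and hence all of N2.\<close>
    have N2_eq: "N2 = \<gamma> 2"
    proof (rule ccontr)
      assume "N2 \<noteq> \<gamma> 2"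
      then obtain Y where Y: "Y \<lhd> G" "\<gamma> 2 \<subseteq> Y" "Y \<subset> N2" "card N2 = p * card Y"
        using chief_factor_below[OF n\<gamma> nN2, of 2] \<gamma>2N2 by blast
      have sY: "subgroup Y G" by (rule normal_imp_subgroup[OF Y(1)])
      have "?\<P> N2 \<subseteq> Y"
        using Y by (intro power_subgroup_leI sY pow_p_mem_of_index_p[OF Y(1) sN2 _ Y(4)]) auto
      then have "\<gamma> 2 <#> ?\<P> N2 \<subseteq> Y" using Y(2) by (intro set_mult_least sY)
      then have "P \<subseteq> Y" using P2 by blast
      then have "N2 \<subseteq> Y" unfolding N2_def by (intro set_mult_least sY Y(2))
      then show False using Y(3) by blast
    qed
    have P\<gamma>2: "P \<subseteq> \<gamma> 2" using set_mult_upper(2)[OF s\<gamma> sP, of 2] N2_eq by (simp add: N2_def)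
    \<comment> \<open>Every normal subgroup of index p in N contains N2, which itself has index p,
      so N2 is the only one.\<close>
    have maximal: "M \<subseteq> \<gamma> 2" if M: "M \<lhd> G" "M \<subset> ?N" for M
    proof -
      obtain Y where Y: "Y \<lhd> G" "M \<subseteq> Y" "Y \<subset> ?N" "card ?N = p * card Y"
        using chief_factor_below[OF M(1) n\<gamma> M(2)] by blast
      have "N2 \<subseteq> Y" using Y by (intro N2_least) auto
      moreover have "card Y = card N2" using Y(4) index_N p_pos by simp
      ultimately have "N2 = Y"
        by (intro card_subset_eq finite_subgroup normal_imp_subgroup[OF Y(1)]) auto
      then show ?thesis using Y(2) N2_eq by simp
    qed
    have p1': "\<gamma> (p - 1) \<subseteq> ?N" using p_ge_2 by (intro \<gamma>_antimono) simp
    have "E' \<noteq> carrier G"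
      using lower_central_subset_of_centralizer_mod[OF normal_power_subgroup[OF nN2], of "p - 1" p]
        False p1 unfolding E'_def \<gamma>_def by auto
    then have "E' \<in> \<E>" unfolding \<E>_def by simp
    then have "x \<notin> E'" by (rule x\<E>)
    then obtain e where e: "e \<in> \<gamma> (p - 1)" "commutator G x e \<notin> ?\<P> N2"
      using x by (auto simp: E'_def centralizer_mod_def)
    have eP: "commutator G x e \<in> P" using \<gamma>_comm'[OF e(1) x] p1 \<gamma>p by auto

    have first: "\<exists>g \<in> ?N. inv c \<otimes> commutator G x g \<in> {\<one>}" if c: "c \<in> \<gamma> 2" for c
    proof (rule commutator_descent[OF x s\<gamma> n\<gamma> _ _ one _ _ c, where A = "{\<one>}"])
      show \<gamma>2N: "\<gamma> 2 \<subseteq> ?N" by (rule \<gamma>_antimono) simp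
      fix K assume K: "K \<lhd> G" "K \<subseteq> ?N" "\<not> \<gamma> 2 \<subseteq> K"
        and IH: "\<And>K' c. K' \<lhd> G \<Longrightarrow> K \<subset> K' \<Longrightarrow> K' \<subseteq> ?N \<Longrightarrow> c \<in> \<gamma> 2 \<Longrightarrow>
          \<exists>g \<in> ?N. inv c \<otimes> commutator G x g \<in> K'"
      have Ks: "subgroup K G" by (rule normal_imp_subgroup[OF K(1)])
      show "\<exists>h \<in> ?N. commutator G x h \<in> ?N \<and> commutator G x h \<notin> K \<and>
        commutator G x h \<in> centralizer_mod G (carrier G) K"
      proof (cases "P \<subseteq> K")
        case True
        then obtain j h where j: "2 \<le> j" "h \<in> \<gamma> (j - 1)" "commutator G x h \<in> \<gamma> j" "commutator G x h \<notin> K"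
          "commutator G x h \<in> centralizer_mod G (carrier G) K"
          using above_P[of 2 K] K by auto
        moreover have "\<gamma> j \<subseteq> ?N" "\<gamma> (j - 1) \<subseteq> ?N" using j(1) by (intro \<gamma>_antimono; simp)+
        ultimately show ?thesis by blast
      next
        case False
        obtain M L c where M: "M \<lhd> G" "M \<subseteq> ?N" and L: "L \<lhd> G" "K \<subseteq> L" "L \<subseteq> M" "card M = p * card L"
          "?\<P> L \<subseteq> K" and c: "c \<in> M" "c [^] p \<notin> K"
          using minimal_power_not_subset[OF n\<gamma> K(1,2)] False unfolding P_def by blast
        show ?thesis
        proof (cases "M = ?N")
          case True
          \<comment> \<open>As N2^p lies in K and c^p does not, c is outside N2 =
            \<open>\<gamma> 2\<close>, out of reach of the induction hypothesis. No p-th power is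
            taken here: P is central modulo N2^p with index at most p, so [x, e] cannot lie in K
            unless P does.\<close>
          then have "N2 \<subseteq> L" using L N2_least by blast
          then have N2K: "?\<P> N2 \<subseteq> K" using power_subgroup_mono[OF L(1), of N2 p] L(5) by blast
          have "commutator G x e \<notin> K"
          proof
            assume "commutator G x e \<in> K"
            from subgroup_of_index_le_p[OF sP snP Ks index_P N2P N2K eP this e(2)]
            show False using \<open>\<not> P \<subseteq> K\<close> by blast
          qed
          moreover have "commutator G x e \<in> centralizer_mod G (carrier G) K"
            using eP central N2K by (auto simp: centralizer_mod_def)
          ultimately show ?thesis using e(1) p1' eP PN by blast
        next
          case False
          then have "M \<subseteq> \<gamma> 2" using maximal M by blast
          then obtain g where g: "g \<in> ?N" "inv c \<otimes> commutator G x g \<in> ?\<P> M <#> K"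
            using IH[of "?\<P> M <#> K" c] PK'[OF M K(1,2) c] c(1) by blast
          \<comment> \<open>One commutator leads from M into L, and by the index bound for L the
            remaining p - 1 lead into L^p. This is where e = 1 closes the gap.\<close>
          have "iterated_commutator G M 1 \<subseteq> L"
            using commutator_subset_of_card[OF L(1) M(1) L(3)] L(4)
              commutator_subgroup_subset_iff[OF subgroup.subset[OF normal_imp_subgroup[OF M(1)]] L(1)]
            by simp
          from iterated_commutator_mono[OF normal_iterated_commutator[OF M(1)] L(1) this, of "p - 1"]
          have "iterated_commutator G M (p - 1 + 1) \<subseteq> iterated_commutator G L (p - 1)"
            unfolding iterated_commutator_add by simp
          also have "\<dots> \<subseteq> ?\<P> L"
            using L(1,3) M(2) by (intro iterated_commutator_subset_of_card normal_power_subgroup boundM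
              power_subgroup_incl normal_imp_subgroup) auto
          finally have "iterated_commutator G M (p - 1 + 1) \<subseteq> K" using L(5) by blast
          then have "commutator G x (g [^] p) \<in> M" "commutator G x (g [^] p) \<notin> K"
            "commutator G x (g [^] p) \<in> centralizer_mod G (carrier G) K"
            using commutator_p_power[OF x M(1) _ boundM[OF M] L(1,3,4) K(1) L(2,5), of 1 g c] M(2) NN g c
            by blast+
          then show ?thesis using M(2) subgroup_nat_pow_closed[OF s\<gamma> g(1)] by blast
        qed
      qed
    qed (use subgroup.one_closed[OF s\<gamma>] in auto)

    \<comment> \<open>Modulo \<open>\<gamma> 2\<close>, which contains P, all required h come from
      \<open>above_P\<close>, and no p-th powers occur.\<close>
    have "\<exists>g \<in> carrier G. inv c \<otimes> commutator G x g \<in> \<gamma> 2"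
    proof (rule commutator_descent[OF x subgroup_self n\<gamma> subset_refl _ n\<gamma> _ _ c, where A = "\<gamma> 2"])
      fix K assume K: "K \<lhd> G" "\<gamma> 2 \<subseteq> K" "\<not> ?N \<subseteq> K"
      then obtain j h where "1 \<le> j" "h \<in> \<gamma> (j - 1)" "commutator G x h \<in> \<gamma> j" "commutator G x h \<notin> K"
        "commutator G x h \<in> centralizer_mod G (carrier G) K"
        using above_P[of 1 K] P\<gamma>2 by auto
      then show "\<exists>h \<in> carrier G. commutator G x h \<in> ?N \<and> commutator G x h \<notin> K \<and>
          commutator G x h \<in> centralizer_mod G (carrier G) K"
        using \<gamma>_antimono[of 1 j] normal_carrier[OF n\<gamma>] by blast
    qed (use \<gamma>_antimono[of 1 2] in auto)
    then obtain g where g: "g \<in> carrier G" "inv c \<otimes> commutator G x g \<in> \<gamma> 2" by blast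
    define z where "z = inv c \<otimes> commutator G x g"
    have cc: "c \<in> carrier G" by (rule normal_carrier[OF n\<gamma> c])
    have zc: "z \<in> carrier G" using cc x g by (simp add: z_def)
    \<comment> \<open>Since [x, g] = c z and [x, h g] = [x, g] g^-1 [x, h] g, the commutator [x, h]
      has to be g z^-1 g^-1. This lies in \<open>\<gamma> 2\<close>, where \<open>first\<close>
      solves exactly.\<close>
    have "g \<otimes> inv z \<otimes> inv g \<in> \<gamma> 2"
      using g subgroup.m_inv_closed[OF s\<gamma>, of z] by (intro normal_conj n\<gamma>) (auto simp: z_def)
    from first[OF this] obtain h where h: "h \<in> ?N"
      "inv (g \<otimes> inv z \<otimes> inv g) \<otimes> commutator G x h \<in> {\<one>}" by blast
    have hc: "h \<in> carrier G" by (rule normal_carrier[OF n\<gamma> h(1)])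
    have xh: "commutator G x h = g \<otimes> inv z \<otimes> inv g"
      using solves[OF h(2) _ hc] g zc by simp
    have "commutator G x (h \<otimes> g) = commutator G x g \<otimes> (inv g \<otimes> commutator G x h \<otimes> g)"
      using x g hc by (simp add: group_word_simps)
    also have "\<dots> = c"
      unfolding xh using x g zc cc by (simp add: z_def inv_mult_group m_assoc mult_inv_cancel)
    finally show ?thesis using cc g hc by (intro bexI[of _ "h \<otimes> g"]) auto
  qed
  then show ?thesis
    using x solves normal_carrier[OF n\<gamma>] by blast
qed

end

section \<open>Indices in quotients\<close>

lemma (in group_hom) image_commutator_subgroup:
  assumes "A \<subseteq> carrier G" "B \<subseteq> carrier G"
  shows "commutator_subgroup H (h ` A) (h ` B) = h ` commutator_subgroup G A B"
proof -
  have "h (commutator G a b) = commutator H (h a) (h b)" if "a \<in> A" "b \<in> B" for a b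
    using assms that by (intro hom_commutator) auto
  then have "{commutator H x y | x y. x \<in> h ` A \<and> y \<in> h ` B} =
      h ` {commutator G a b | a b. a \<in> A \<and> b \<in> B}"
    by (auto simp: image_iff) metis+
  moreover have "{commutator G a b | a b. a \<in> A \<and> b \<in> B} \<subseteq> carrier G"
    using assms by (rule G.commutator_set_carrier)
  ultimately show ?thesis
    unfolding commutator_subgroup_def by (simp add: generate_img)
qed

lemma (in group_hom) image_iterated_commutator:
  assumes "N \<lhd> G" "h ` carrier G = carrier H"
  shows "iterated_commutator H (h ` N) i = h ` iterated_commutator G N i"
proof (induction i)
  case (Suc i)
  have "iterated_commutator G N i \<subseteq> carrier G"
    by (intro subgroup.subset normal_imp_subgroup G.normal_iterated_commutator assms)
  then show ?case
    using image_commutator_subgroup[OF _ subset_refl] assms(2) by (simp add: Suc)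
qed simp

lemma (in group) card_subgroup_index:
  assumes "subgroup A G" "subgroup B G" "B \<subseteq> A"
  shows "subgroup_index G A B * card B = card A"
  using group.lagrange[OF subgroup_imp_group[OF assms(1)] subgroup_incl[OF assms(2,1,3)]]
  by (simp add: subgroup_index_def order_def)

lemma (in group) card_image_FactGroup:
  assumes K: "K \<lhd> G" and N: "N \<lhd> G"
  shows "card ((\<lambda>a. K #> a) ` N) * card K = card (N <#> K)"
proof -
  interpret \<phi>: group_hom G "G Mod K" "\<lambda>a. K #> a"
    by (rule group_hom_FactGroup[OF K])
  have Ks: "subgroup K G" and Ns: "subgroup N G" and sNK: "subgroup (N <#> K) G"
    using K N by (auto intro!: normal_imp_subgroup normal_set_mult)
  have "(\<lambda>a. K #> a) ` (N <#> K) \<subseteq> (\<lambda>a. K #> a) ` N"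
  proof
    fix y assume "y \<in> (\<lambda>a. K #> a) ` (N <#> K)"
    then obtain n k where nk: "n \<in> N" "k \<in> K" "y = K #> (n \<otimes> k)"
      by (auto simp: set_mult_def)
    have c: "n \<in> carrier G" "k \<in> carrier G"
      using nk subgroup.mem_carrier[OF Ns] subgroup.mem_carrier[OF Ks] by auto
    have "K #> k = \<one>\<^bsub>G Mod K\<^esub>" using coset_join2[OF c(2) Ks nk(2)] by simp
    moreover have "y = (K #> n) \<otimes>\<^bsub>G Mod K\<^esub> (K #> k)"
      unfolding nk(3) by (rule \<phi>.hom_mult[OF c])
    moreover have "(K #> n) \<otimes>\<^bsub>G Mod K\<^esub> \<one>\<^bsub>G Mod K\<^esub> = K #> n"
      by (rule \<phi>.H.r_one[OF \<phi>.hom_closed[OF c(1)]])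
    ultimately show "y \<in> (\<lambda>a. K #> a) ` N" using nk(1) by auto
  qed
  then have "(\<lambda>a. K #> a) ` N = (\<lambda>a. K #> a) ` (N <#> K)"
    using set_mult_upper(1)[OF Ns Ks] by blast
  also have "\<dots> = rcosets\<^bsub>G\<lparr>carrier := N <#> K\<rparr>\<^esub> K"
    by (auto simp: RCOSETS_def r_coset_def)
  finally show ?thesis
    using card_subgroup_index[OF sNK Ks set_mult_upper(2)[OF Ns Ks]]
    by (simp add: subgroup_index_def)
qed

text \<open>Translates uniseriality of G/K on N/K into orders of subgroups of G containing K: a
  subgroup A has image of order |AK| / |K| in the quotient, and the factor |K| occurs on both
  sides.\<close>

lemma (in finite_p_group) uniserial_modulo_card:
  assumes N: "N \<lhd> G" and K: "K \<lhd> G" and uni: "uniserial_modulo p G N K"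
  shows "card (iterated_commutator G N i <#> K) \<le> p * card (iterated_commutator G N (Suc i) <#> K)"
proof -
  let ?\<phi> = "\<lambda>a. K #> a" and ?I = "iterated_commutator G N"
  interpret \<phi>: group_hom G "G Mod K" ?\<phi> by (rule group_hom_FactGroup[OF K])
  have nI: "?I j \<lhd> G" and sI: "subgroup (?I j) G" for j
    using N by (auto intro: normal_imp_subgroup normal_iterated_commutator)
  have "carrier (G\<lparr>carrier := N\<rparr> Mod K) = ?\<phi> ` N"
    by (simp add: carrier_FactGroup r_coset_def)
  then have "iterated_commutator (G Mod K) (carrier (G\<lparr>carrier := N\<rparr> Mod K)) j = ?\<phi> ` ?I j" for j
    using \<phi>.image_iterated_commutator[OF N] by (simp add: carrier_FactGroup)
  then have "subgroup_index (G Mod K) (?\<phi> ` ?I i) (?\<phi> ` ?I (Suc i)) \<le> p"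
    using uni unfolding uniserial_modulo_def uniserial_def by metis
  moreover have "?I (Suc i) \<subseteq> ?I i" by (rule iterated_commutator_antimono[OF N]) simp
  then have "subgroup_index (G Mod K) (?\<phi> ` ?I i) (?\<phi> ` ?I (Suc i)) * card (?\<phi> ` ?I (Suc i)) =
      card (?\<phi> ` ?I i)"
    by (intro \<phi>.H.card_subgroup_index \<phi>.subgroup_img_is_subgroup sI image_mono)
  ultimately have "card (?\<phi> ` ?I i) \<le> p * card (?\<phi> ` ?I (Suc i))"
    by (metis mult_le_mono1)
  then have "card (?\<phi> ` ?I i) * card K \<le> p * card (?\<phi> ` ?I (Suc i)) * card K"
    by (rule mult_le_mono1)
  then show ?thesis
    by (simp only: mult.assoc card_image_FactGroup[OF K nI])
qed

theorem theoremB: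
  fixes p :: nat and G :: "('a, 'b) monoid_scheme" and d :: real
  assumes "Factorial_Ring.prime p"
    and "p_group p G"
    and "d = log p (subgroup_index G (derived G (carrier G))
                      (power_subgroup G (derived G (carrier G)) p))"
    and "d \<le> real p - 1"
    and "uniserial_modulo p G (derived G (carrier G)) (power_subgroup G (derived G (carrier G)) p)"
  shows "\<exists>x \<in> carrier G. derived G (carrier G) = {commutator G x g | g. g \<in> carrier G}"
proof -
  interpret finite_p_group G p
    using assms(1,2) by (simp add: p_group_def finite_p_group_def finite_p_group_axioms_def)
  let ?\<gamma> = "iterated_commutator G (carrier G)"
  let ?P = "power_subgroup G (?\<gamma> 1) p"
  have D: "derived G (carrier G) = ?\<gamma> 1"
    by (simp add: derived_eq_commutator_subgroup[OF subgroup_self])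
  have nD: "?\<gamma> 1 \<lhd> G" by (rule normal_iterated_commutator[OF normal_self])
  have nP: "?P \<lhd> G" by (rule normal_power_subgroup[OF nD])
  have sD: "subgroup (?\<gamma> 1) G" and sP: "subgroup ?P G"
    using nD nP by (auto intro: normal_imp_subgroup)
  have PD: "?P \<subseteq> ?\<gamma> 1" by (rule power_subgroup_incl[OF sD])
  have index: "subgroup_index G (?\<gamma> 1) ?P * card ?P = card (?\<gamma> 1)"
    by (rule card_subgroup_index[OF sD sP PD])
  \<comment> \<open>The index divides a power of p, so the real logarithm d is a natural number
    m.\<close>
  obtain n where "card (?\<gamma> 1) = p ^ n" using card_subgroup_power[OF sD] by blast
  then have "subgroup_index G (?\<gamma> 1) ?P dvd p ^ n"
    using index by (metis dvd_triv_left)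
  then obtain m where m: "subgroup_index G (?\<gamma> 1) ?P = p ^ m"
    using divides_primepow_nat[OF prime_p] by blast
  have "d = real m"
    using assms(3) p_ge_2 unfolding D m by (simp add: log_nat_power)
  then have "m \<le> p - 1" using assms(4) p_pos by linarith
  \<comment> \<open>The hypothesis counts commutators starting from G' = \<open>?\<gamma> 1\<close>,
    hence the shift from i to i - 1.\<close>
  moreover have "card (?\<gamma> i <#>\<^bsub>G\<^esub> ?P) \<le> p * card (?\<gamma> (Suc i) <#>\<^bsub>G\<^esub> ?P)"
    if "1 \<le> i" for i
    using uniserial_modulo_card[OF nD nP assms(5)[unfolded D], of "i - 1"] that
    unfolding iterated_commutator_add by (simp del: iterated_commutator.simps)
  ultimately obtain x where x: "x \<in> carrier G"
    "\<forall>c \<in> ?\<gamma> 1. \<exists>g \<in> carrier G. commutator G x g = c"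
    using uniserial_derived_commutators[of m] index unfolding m by auto
  have "commutator G x g \<in> ?\<gamma> 1" if "g \<in> carrier G" for g
    using iterated_commutator_memI[of x "carrier G" 0 g] x(1) that by simp
  then have "{commutator G x g | g. g \<in> carrier G} \<subseteq> ?\<gamma> 1" by blast
  moreover have "?\<gamma> 1 \<subseteq> {commutator G x g | g. g \<in> carrier G}"
  proof
    fix c assume "c \<in> ?\<gamma> 1"
    then obtain g where "g \<in> carrier G" "c = commutator G x g" using x(2) by metis
    then show "c \<in> {commutator G x g | g. g \<in> carrier G}" by blast
  qed
  ultimately show ?thesis unfolding D using x(1) by blast
qed

end
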